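(* There is a constant $C$ such that for every $N$ and every two binary strings $a,b$ of length at most $N$ there exists a binary string $f$ of length exactly $\mathrm{KS}(b\mid a)$ such that $$\mathrm{KS}(b\mid f,a)\le C\log N\quad\text{and}\quad \bigl|\mathrm{KS}(b\mid f)-\min\{\mathrm{KS}(a),\mathrm{KS}(b)\}\bigr|\le C\log N.$$
   Context: $\mathrm{KS}(u)$ and $\mathrm{KS}(u\mid v)$ denote plain and conditional Kolmogorov complexity of binary strings with respect to a fixed optimal programming language; conditioning on two strings means conditioning on an encoding of the pair. *)

theory Defs
  imports Complex_Main
begin

datatype recf = Zero | Succ | Proj nat | Comp recf "recf list" | Prim recf recf | Mn recf

inductive evalr :: "recf \<Rightarrow> nat list \<Rightarrow> nat \<Rightarrow> bool" where
  zero: "evalr Zero xs 0"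
| succ: "evalr Succ (x # xs) (Suc x)"
| proj: "i < length xs \<Longrightarrow> evalr (Proj i) xs (xs ! i)"
| comp: "list_all2 (\<lambda>g y. evalr g xs y) gs ys \<Longrightarrow> evalr f ys z \<Longrightarrow> evalr (Comp f gs) xs z"
| prim0: "evalr f xs z \<Longrightarrow> evalr (Prim f g) (0 # xs) z"
| primS: "evalr (Prim f g) (n # xs) y \<Longrightarrow> evalr g (y # n # xs) z
           \<Longrightarrow> evalr (Prim f g) (Suc n # xs) z"
| mn: "evalr f (n # xs) 0 \<Longrightarrow> (\<forall>m<n. \<exists>y. evalr f (m # xs) (Suc y))
           \<Longrightarrow> evalr (Mn f) xs n"

text \<open>Binary strings are lists of booleans. Bijective numbering of binary strings
  (used only to transfer computability from natural numbers to strings).\<close>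
fun nat_of_str :: "bool list \<Rightarrow> nat" where
  "nat_of_str [] = 0"
| "nat_of_str (b # s) = 2 * nat_of_str s + (if b then 2 else 1)"

definition computable2 :: "(bool list \<Rightarrow> bool list \<Rightarrow> bool list option) \<Rightarrow> bool" where
  "computable2 F \<longleftrightarrow> (\<exists>f. \<forall>p v u.
      evalr f [nat_of_str p, nat_of_str v] (nat_of_str u) \<longleftrightarrow> F p v = Some u)"

definition optimal_lang :: "(bool list \<Rightarrow> bool list \<Rightarrow> bool list option) \<Rightarrow> bool" where
  "optimal_lang D \<longleftrightarrow> computable2 D \<and>
     (\<forall>D'. computable2 D' \<longrightarrow> (\<exists>c. \<forall>p v u. D' p v = Some u \<longrightarrow>
        (\<exists>p'. D p' v = Some u \<and> length p' \<le> length p + c)))"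

definition KSc :: "(bool list \<Rightarrow> bool list \<Rightarrow> bool list option) \<Rightarrow> bool list \<Rightarrow> bool list \<Rightarrow> nat" where
  "KSc D u v = (LEAST n. \<exists>p. length p = n \<and> D p v = Some u)"

definition KS :: "(bool list \<Rightarrow> bool list \<Rightarrow> bool list option) \<Rightarrow> bool list \<Rightarrow> nat" where
  "KS D u = KSc D u []"

definition pair_str :: "bool list \<Rightarrow> bool list \<Rightarrow> bool list" where
  "pair_str u v = concat (map (\<lambda>b. [b, b]) u) @ [False, True] @ v"

end

theory Submission
  imports Defs "HOL-Library.Nat_Bijection" "HOL-Library.FuncSet"
begin

text \<open>
  Let \<open>p\<close> be a shortest program of \<open>b\<close> given \<open>a\<close>, and let \<open>k\<close> be its length. The strings \<open>f\<close>
  considered are the translates of \<open>p\<close> modulo \<open>2 ^ k\<close> by one of \<open>N + 2 * k + 5\<close> computable shifts that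
  depend on \<open>a\<close>: from \<open>f\<close>, \<open>a\<close> and the number of the shift one recovers \<open>p\<close>, hence \<open>b\<close>.
  The shifts (found by exhaustive search) are such that for every set \<open>T\<close> of at most half of the
  strings of length \<open>k\<close>, at most \<open>card T\<close> strings \<open>a\<close> have some \<open>i\<close> all of whose translates lie in \<open>T\<close>.

  Suppose that every translate \<open>f\<close> of \<open>p\<close> satisfies \<open>K b f < m\<close>, where \<open>m\<close> is slightly less than
  \<open>min (K a) (K b)\<close>. Let \<open>T\<close> be the set of all \<open>f\<close> of length \<open>k\<close> with \<open>K b f < m\<close>, and let \<open>h\<close> be the
  logarithm of its size. Fewer than \<open>2 ^ (k + m)\<close> pairs \<open>(b, f)\<close> satisfy the inequality, so
  \<open>K b \<le> k + m - h\<close> up to logarithmic terms, which makes \<open>T\<close> smaller than half. By the choice of the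
  shifts, \<open>K a b \<le> h\<close>. Symmetry of information, \<open>K a + K b a \<le> K b + K a b\<close>, then gives
  \<open>K a \<le> m\<close>, a contradiction.
\<close>

section \<open>Total computable functions\<close>

inductive_cases evalr_ZeroE: "evalr Zero xs z"
inductive_cases evalr_SuccE: "evalr Succ xs z"
inductive_cases evalr_ProjE: "evalr (Proj i) xs z"
inductive_cases evalr_CompE: "evalr (Comp f gs) xs z"
inductive_cases evalr_PrimE: "evalr (Prim f g) xs z"
inductive_cases evalr_Prim0E: "evalr (Prim f g) (0 # xs) z"
inductive_cases evalr_PrimSucE: "evalr (Prim f g) (Suc n # xs) z"
inductive_cases evalr_MnE: "evalr (Mn f) xs n"

text \<open>Induction on the first derivation. For \<open>Mn\<close>, two distinct results would
  give \<open>f\<close> both the value 0 and a successor at the smaller one.\<close>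

lemma evalr_deterministic: "evalr f xs y \<Longrightarrow> evalr f xs z \<Longrightarrow> y = z"
proof (induction arbitrary: z rule: evalr.induct)
  case (zero xs)
  then show ?case by (blast elim: evalr_ZeroE)
next
  case (succ x xs)
  then show ?case by (blast elim: evalr_SuccE)
next
  case (proj i xs)
  then show ?case by (blast elim: evalr_ProjE)
next
  case (comp xs gs ys f z')
  from comp.prems obtain ys' where ys': "list_all2 (\<lambda>g y. evalr g xs y) gs ys'" "evalr f ys' z"
    by (rule evalr_CompE)
  from comp.IH(1) ys'(1) have "ys = ys'"
  proof (induction gs ys arbitrary: ys' rule: list_all2_induct)
    case Nil
    then show ?case by simp
  next
    case (Cons g gs y ys)
    then obtain y' ys'' where "ys' = y' # ys''" "evalr g xs y'"
      "list_all2 (\<lambda>g y. evalr g xs y) gs ys''"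
      by (auto simp: list_all2_Cons1)
    then show ?case using Cons.IH Cons.hyps(1) by blast
  qed
  then show ?case using comp.IH(2) ys'(2) by blast
next
  case (prim0 f xs z' g)
  then show ?case by (blast elim: evalr_Prim0E)
next
  case (primS f g n xs y z')
  from primS.prems obtain y' where "evalr (Prim f g) (n # xs) y'" "evalr g (y' # n # xs) z"
    by (rule evalr_PrimSucE)
  then show ?case using primS.IH by blast
next
  case (mn f n xs)
  from mn.prems have z: "evalr f (z # xs) 0" and below: "\<forall>m<z. \<exists>y. evalr f (m # xs) (Suc y)"
    by (rule evalr_MnE; simp)+
  show ?case
  proof (rule linorder_cases[of n z])
    assume "n < z"
    with below mn.IH(1) show ?thesis by blast
  next
    assume "z < n"
    with z mn.IH(2) show ?thesis by blast
  qed
qed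

text \<open>List arguments allow projections and reorderings of any arity. This form serves to build
  programs; the unary \<open>tc\<close> is the working notion afterwards.\<close>

definition ncomp :: "nat \<Rightarrow> (nat list \<Rightarrow> nat) \<Rightarrow> bool" where
  "ncomp n F \<longleftrightarrow> (\<exists>r. \<forall>xs. length xs = n \<longrightarrow> evalr r xs (F xs))"

definition tc :: "(nat \<Rightarrow> nat) \<Rightarrow> bool" where
  "tc f \<longleftrightarrow> (\<exists>r. \<forall>x. evalr r [x] (f x))"

definition tc2 :: "(nat \<Rightarrow> nat \<Rightarrow> nat) \<Rightarrow> bool" where
  "tc2 h \<longleftrightarrow> (\<exists>r. \<forall>x y. evalr r [x, y] (h x y))"

lemma ncomp_proj: "i < n \<Longrightarrow> ncomp n (\<lambda>xs. xs ! i)"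
  unfolding ncomp_def by (metis evalr.proj)

lemma tc_ncomp: "tc f \<Longrightarrow> ncomp n F \<Longrightarrow> ncomp n (\<lambda>xs. f (F xs))"
  unfolding ncomp_def tc_def
proof (elim exE)
  fix r s assume "\<forall>x. evalr r [x] (f x)" "\<forall>xs. length xs = n \<longrightarrow> evalr s xs (F xs)"
  then have "\<forall>xs. length xs = n \<longrightarrow> evalr (Comp r [s]) xs (f (F xs))"
    by (auto intro!: evalr.comp[where ys="[F _]"])
  then show "\<exists>r. \<forall>xs. length xs = n \<longrightarrow> evalr r xs (f (F xs))" by blast
qed

lemma tc2_ncomp:
  "tc2 h \<Longrightarrow> ncomp n F \<Longrightarrow> ncomp n G \<Longrightarrow> ncomp n (\<lambda>xs. h (F xs) (G xs))"
  unfolding ncomp_def tc2_def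
proof (elim exE)
  fix r s t assume "\<forall>x y. evalr r [x, y] (h x y)" "\<forall>xs. length xs = n \<longrightarrow> evalr s xs (F xs)"
    "\<forall>xs. length xs = n \<longrightarrow> evalr t xs (G xs)"
  then have "\<forall>xs. length xs = n \<longrightarrow> evalr (Comp r [s, t]) xs (h (F xs) (G xs))"
    by (auto intro!: evalr.comp[where ys="[F _, G _]"])
  then show "\<exists>r. \<forall>xs. length xs = n \<longrightarrow> evalr r xs (h (F xs) (G xs))" by blast
qed

lemma ncomp_tc: "ncomp (Suc 0) (\<lambda>xs. f (xs ! 0)) \<Longrightarrow> tc f"
  unfolding ncomp_def tc_def by (metis length_Cons list.size(3) nth_Cons_0)

lemma ncomp_tc2: "ncomp 2 (\<lambda>xs. h (xs ! 0) (xs ! 1)) \<Longrightarrow> tc2 h"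
  unfolding ncomp_def tc2_def
  by (metis One_nat_def length_Cons list.size(3) nth_Cons_0 nth_Cons_Suc numeral_2_eq_2)

lemma tc_const: "tc (\<lambda>x. c)"
proof (induction c)
  case 0
  show ?case unfolding tc_def by (metis evalr.zero)
next
  case (Suc c)
  then obtain r where "\<forall>x. evalr r [x] c" unfolding tc_def by blast
  then have "\<forall>x. evalr (Comp Succ [r]) [x] (Suc c)"
    by (auto intro!: evalr.comp[where ys="[c]"] evalr.succ)
  then show ?case unfolding tc_def by blast
qed

lemma ncomp_const: "0 < n \<Longrightarrow> ncomp n (\<lambda>xs. c)"
  using tc_ncomp[OF tc_const ncomp_proj] .

lemma tc_id: "tc (\<lambda>x. x)"
  unfolding tc_def using evalr.proj[of 0 "[_]"] by fastforce

lemma tc_Suc_raw: "tc Suc"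
  unfolding tc_def by (metis evalr.succ)

lemma tc_comp:
  assumes "tc f" "tc g"
  shows "tc (\<lambda>x. f (g x))"
  by (rule ncomp_tc, rule tc_ncomp[OF assms(1)], rule tc_ncomp[OF assms(2)], rule ncomp_proj, simp)

lemma tc2_comp:
  assumes "tc2 h" "tc f" "tc g"
  shows "tc (\<lambda>x. h (f x) (g x))"
  by (rule ncomp_tc, rule tc2_ncomp[OF assms(1)]; rule tc_ncomp[OF assms(2)] tc_ncomp[OF assms(3)],
      rule ncomp_proj, simp)

text \<open>\<open>Prim\<close> hands its step function the accumulated value, then the index, then
  the parameter; this fixes the argument order of \<open>h\<close>.\<close>

lemma tc2_rec:
  assumes "tc a" and "ncomp 3 (\<lambda>xs. h (xs ! 0) (xs ! 1) (xs ! 2))"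
  shows "tc2 (\<lambda>n x. rec_nat (a x) (\<lambda>n y. h y n x) n)"
proof -
  obtain r s where r: "\<And>x. evalr r [x] (a x)"
    and s: "\<And>xs. length xs = 3 \<Longrightarrow> evalr s xs (h (xs ! 0) (xs ! 1) (xs ! 2))"
    using assms unfolding tc_def ncomp_def by blast
  have "evalr (Prim r s) [n, x] (rec_nat (a x) (\<lambda>n y. h y n x) n)" for n x
  proof (induction n)
    case 0
    then show ?case by (simp add: r evalr.prim0)
  next
    case (Suc n)
    from evalr.primS[OF Suc s[of "[_, n, x]", simplified]]
    show ?case by simp
  qed
  then show ?thesis unfolding tc2_def by blast
qed

section \<open>Basic arithmetic\<close>

lemma tc2_add: "tc2 (+)"
proof -
  have "tc2 (\<lambda>n x. rec_nat x (\<lambda>n y. Suc y) n)"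
    by (rule tc2_rec[OF tc_id]) (intro tc_ncomp[OF tc_Suc_raw] ncomp_proj; simp)
  moreover have "rec_nat x (\<lambda>n y. Suc y) n = n + x" for n x :: nat by (induction n) auto
  ultimately show ?thesis by simp
qed

lemma tc2_mult: "tc2 (*)"
proof -
  have "tc2 (\<lambda>n x. rec_nat 0 (\<lambda>n y. y + x) n)"
    by (rule tc2_rec[OF tc_const]) (intro tc2_ncomp[OF tc2_add] ncomp_proj; simp)
  moreover have "rec_nat 0 (\<lambda>n y. y + x) n = n * x" for n x :: nat by (induction n) auto
  ultimately show ?thesis by simp
qed

text \<open>A recursion whose step ignores the accumulated value returns the last index, which is
  the predecessor.\<close>

lemma tc_pred: "tc (\<lambda>x. x - 1)"
proof -
  have "tc2 (\<lambda>n x. rec_nat 0 (\<lambda>n y. n) n)"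
    by (rule tc2_rec[OF tc_const]) (intro ncomp_proj; simp)
  moreover have "rec_nat 0 (\<lambda>n y. n) n = n - 1" for n :: nat by (cases n) auto
  ultimately have "tc2 (\<lambda>n x. n - 1)" by simp
  from tc2_comp[OF this tc_id tc_id] show ?thesis .
qed

lemma tc2_diff: "tc2 (-)"
proof -
  have "tc2 (\<lambda>n x. rec_nat x (\<lambda>n y. y - 1) n)"
    by (rule tc2_rec[OF tc_id]) (intro tc_ncomp[OF tc_pred] ncomp_proj; simp)
  moreover have "rec_nat x (\<lambda>n y. y - 1) n = x - n" for n x :: nat by (induction n) auto
  ultimately have "tc2 (\<lambda>n x. x - n)" by simp
  \<comment> \<open>The recursion runs on its first argument, the subtrahend, so the two arguments
    have to be exchanged.\<close>
  then have "ncomp 2 (\<lambda>xs. (xs ! 0) - (xs ! 1))"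
    using tc2_ncomp[of "\<lambda>n x. x - n" 2 "\<lambda>xs. xs ! 1" "\<lambda>xs. xs ! 0"] by (simp add: ncomp_proj)
  then show ?thesis by (rule ncomp_tc2)
qed

lemma tc_Suc: "tc f \<Longrightarrow> tc (\<lambda>x. Suc (f x))"
  by (rule tc_comp[OF tc_Suc_raw])
lemma tc_add: "tc f \<Longrightarrow> tc g \<Longrightarrow> tc (\<lambda>x. f x + g x)"
  by (rule tc2_comp[OF tc2_add])
lemma tc_mult: "tc f \<Longrightarrow> tc g \<Longrightarrow> tc (\<lambda>x. f x * g x)"
  by (rule tc2_comp[OF tc2_mult])
lemma tc_diff: "tc f \<Longrightarrow> tc g \<Longrightarrow> tc (\<lambda>x. f x - g x)"
  by (rule tc2_comp[OF tc2_diff])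

section \<open>The Cantor pairing and its inverse\<close>

definition pair :: "nat \<Rightarrow> nat \<Rightarrow> nat" where "pair x y = prod_encode (x, y)"
definition pfst :: "nat \<Rightarrow> nat" where "pfst z = fst (prod_decode z)"
definition psnd :: "nat \<Rightarrow> nat" where "psnd z = snd (prod_decode z)"

lemma pfst_pair [simp]: "pfst (pair x y) = x"
  and psnd_pair [simp]: "psnd (pair x y) = y"
  and pair_pfst_psnd [simp]: "pair (pfst z) (psnd z) = z"
  by (simp_all add: pair_def pfst_def psnd_def)

lemma tc_triangle_raw: "tc triangle"
proof -
  have "tc2 (\<lambda>n x. rec_nat 0 (\<lambda>n y. y + Suc n) n)"
    by (rule tc2_rec[OF tc_const]) (intro tc2_ncomp[OF tc2_add] tc_ncomp[OF tc_Suc_raw] ncomp_proj; simp)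
  moreover have "rec_nat 0 (\<lambda>n y. y + Suc n) n = triangle n" for n :: nat by (induction n) auto
  ultimately have "tc2 (\<lambda>n x. triangle n)" by simp
  from tc2_comp[OF this tc_id tc_id] show ?thesis .
qed

lemma tc2_pair: "tc2 pair"
proof -
  have "ncomp 2 (\<lambda>xs. triangle (xs ! 0 + xs ! 1) + xs ! 0)"
    by (intro tc2_ncomp[OF tc2_add] tc_ncomp[OF tc_triangle_raw] ncomp_proj; simp)
  then have "ncomp 2 (\<lambda>xs. pair (xs ! 0) (xs ! 1))"
    by (simp add: pair_def prod_encode_def)
  then show ?thesis by (rule ncomp_tc2)
qed

lemma tc_pair: "tc f \<Longrightarrow> tc g \<Longrightarrow> tc (\<lambda>x. pair (f x) (g x))"
  by (rule tc2_comp[OF tc2_pair])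

text \<open>The antidiagonal of \<open>z\<close>: the largest \<open>y\<close> with
  \<open>triangle y \<le> z\<close>. The truncated difference is 1 exactly when the next triangular
  number has been reached, so primitive recursion suffices to invert the pairing.\<close>

definition diagonal :: "nat \<Rightarrow> nat" where
  "diagonal z = rec_nat 0 (\<lambda>n y. y + (1 - (triangle (Suc y) - Suc n))) z"

lemma tc_diagonal: "tc diagonal"
proof -
  have "tc2 (\<lambda>n x. rec_nat 0 (\<lambda>n y. y + (1 - (triangle (Suc y) - Suc n))) n)"
    by (rule tc2_rec[OF tc_const])
      (intro tc2_ncomp[OF tc2_add] tc2_ncomp[OF tc2_diff] tc_ncomp[OF tc_triangle_raw]
         ncomp_const tc_ncomp[OF tc_Suc_raw] ncomp_proj; simp)
  then have "tc2 (\<lambda>n x. diagonal n)" by (simp add: diagonal_def)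
  from tc2_comp[OF this tc_id tc_id] show ?thesis .
qed

lemma diagonal_bounds: "triangle (diagonal z) \<le> z \<and> z < triangle (Suc (diagonal z))"
proof (induction z)
  case 0
  then show ?case by (simp add: diagonal_def)
next
  case (Suc z)
  have "diagonal (Suc z) = diagonal z + (1 - (triangle (Suc (diagonal z)) - Suc z))"
    by (simp add: diagonal_def)
  then show ?case using Suc by (cases "triangle (Suc (diagonal z)) \<le> Suc z") auto
qed

lemma triangle_mono: "m \<le> n \<Longrightarrow> triangle m \<le> triangle n"
  by (rule lift_Suc_mono_le[of triangle]) auto

text \<open>With \<open>x\<close> and \<open>y\<close> the components, \<open>z\<close> is
  \<open>triangle (x + y) + x\<close>, which lies between two consecutive triangular numbers; these
  determine the diagonal.\<close>

lemma diagonal_eq: "diagonal z = pfst z + psnd z"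
proof -
  have z: "z = triangle (pfst z + psnd z) + pfst z"
    using pair_pfst_psnd[of z] by (simp add: pair_def prod_encode_def)
  show ?thesis
  proof (rule linorder_cases[of "diagonal z" "pfst z + psnd z"])
    assume "diagonal z < pfst z + psnd z"
    then show ?thesis
      using diagonal_bounds[of z] triangle_mono[of "Suc (diagonal z)" "pfst z + psnd z"] z
        triangle_Suc[of "pfst z + psnd z"] by linarith
  next
    assume "pfst z + psnd z < diagonal z"
    then show ?thesis
      using diagonal_bounds[of z] triangle_mono[of "Suc (pfst z + psnd z)" "diagonal z"] z
        triangle_Suc[of "pfst z + psnd z"] by linarith
  qed
qed

lemma tc_pfst: "tc f \<Longrightarrow> tc (\<lambda>x. pfst (f x))"
proof -
  have "pfst z = z - triangle (diagonal z)" for z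
    using pair_pfst_psnd[of z] by (simp add: pair_def prod_encode_def diagonal_eq)
  then have "pfst = (\<lambda>z. z - triangle (diagonal z))" by (rule ext)
  then have "tc pfst"
    using tc_diff[OF tc_id tc_comp[OF tc_triangle_raw tc_diagonal]] by simp
  then show "tc f \<Longrightarrow> tc (\<lambda>x. pfst (f x))" by (rule tc_comp)
qed

lemma tc_psnd: "tc f \<Longrightarrow> tc (\<lambda>x. psnd (f x))"
proof -
  have "psnd z = diagonal z - pfst z" for z by (simp add: diagonal_eq)
  then have "psnd = (\<lambda>z. diagonal z - pfst z)" by (rule ext)
  then have "tc psnd"
    using tc_diff[OF tc_diagonal tc_pfst[OF tc_id]] by simp
  then show "tc f \<Longrightarrow> tc (\<lambda>x. psnd (f x))" by (rule tc_comp)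
qed

text \<open>In the rules for binders the bound variable is paired with the parameter, so that all
  predicates and functions stay unary and the rules apply by higher-order pattern unification.\<close>

lemma tc_rec:
  assumes "tc a" "tc g" and h: "tc (\<lambda>z. h (pfst z) (pfst (psnd z)) (psnd (psnd z)))"
  shows "tc (\<lambda>x. rec_nat (a x) (\<lambda>n y. h x n y) (g x))"
proof -
  have "ncomp 3 (\<lambda>xs. h (xs ! 2) (xs ! 1) (xs ! 0))"
    using tc_ncomp[OF h, of 3 "\<lambda>xs. pair (xs ! 2) (pair (xs ! 1) (xs ! 0))"]
    by (simp add: tc2_ncomp[OF tc2_pair] ncomp_proj)
  from tc2_comp[OF tc2_rec[OF assms(1) this] assms(2) tc_id]
  show ?thesis .
qed

lemma tc_sum:
  assumes "tc g" and "tc (\<lambda>z. h (pfst z) (psnd z))"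
  shows "tc (\<lambda>x. \<Sum>y<g x. h x y)"
proof -
  have "rec_nat 0 (\<lambda>n y. y + h x n) m = (\<Sum>y<m. h x y)" for x m
    by (induction m) auto
  moreover have "tc (\<lambda>x. rec_nat 0 (\<lambda>n y. y + h x n) (g x))"
    using tc_comp[OF assms(2), of "\<lambda>z. pair (pfst z) (pfst (psnd z))"]
    by (intro tc_rec tc_const assms tc_add tc_psnd tc_id) (simp add: tc_pair tc_pfst tc_psnd tc_id)
  ultimately show ?thesis by simp
qed

lemma tc_power:
  assumes "tc f" "tc g"
  shows "tc (\<lambda>x. f x ^ g x)"
proof -
  have "rec_nat 1 (\<lambda>n y. y * a) m = a ^ m" for a m :: nat
    by (induction m) auto
  moreover have "tc (\<lambda>x. rec_nat 1 (\<lambda>n y. y * f x) (g x))"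
    by (intro tc_rec tc_const tc_mult tc_psnd tc_id tc_comp[OF assms(1) tc_pfst[OF tc_id]] assms)
  ultimately show ?thesis by simp
qed

section \<open>Decidable predicates and unbounded search\<close>

definition dec :: "(nat \<Rightarrow> bool) \<Rightarrow> bool" where
  "dec P \<longleftrightarrow> tc (\<lambda>x. of_bool (P x))"

lemma tc_of_bool: "dec P \<Longrightarrow> tc (\<lambda>x. of_bool (P x))"
  by (simp add: dec_def)

lemma dec_le: "tc f \<Longrightarrow> tc g \<Longrightarrow> dec (\<lambda>x. f x \<le> g x)"
proof -
  assume "tc f" "tc g"
  then have "tc (\<lambda>x. 1 - (f x - g x))" by (intro tc_diff tc_const)
  moreover have "1 - (f x - g x) = of_bool (f x \<le> g x)" for x by auto
  ultimately show ?thesis by (simp add: dec_def)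
qed

lemma dec_less: "tc f \<Longrightarrow> tc g \<Longrightarrow> dec (\<lambda>x. f x < g x)"
  using dec_le[OF tc_Suc, of f g] by (simp add: Suc_le_eq)

lemma dec_not: "dec P \<Longrightarrow> dec (\<lambda>x. \<not> P x)"
proof -
  assume "dec P"
  then have "tc (\<lambda>x. 1 - of_bool (P x))" unfolding dec_def by (intro tc_diff tc_const)
  moreover have "1 - of_bool (P x) = (of_bool (\<not> P x) :: nat)" for x by auto
  ultimately show ?thesis by (simp add: dec_def)
qed

lemma dec_conj: "dec P \<Longrightarrow> dec Q \<Longrightarrow> dec (\<lambda>x. P x \<and> Q x)"
  unfolding dec_def of_bool_conj by (rule tc_mult)

lemma dec_disj:
  assumes "dec P" "dec Q"
  shows "dec (\<lambda>x. P x \<or> Q x)"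
proof -
  have "dec (\<lambda>x. \<not> (\<not> P x \<and> \<not> Q x))" by (intro dec_not dec_conj assms)
  then show ?thesis by simp
qed

lemma dec_imp:
  assumes "dec P" "dec Q"
  shows "dec (\<lambda>x. P x \<longrightarrow> Q x)"
  unfolding imp_conv_disj by (intro dec_disj dec_not assms)

lemma dec_eq:
  assumes "tc f" "tc g"
  shows "dec (\<lambda>x. f x = g x)"
  using dec_conj[OF dec_le[OF assms] dec_le[OF assms(2,1)]] unfolding order_eq_iff[symmetric] .

text \<open>The quantifier holds iff the number of counterexamples, a bounded sum, is zero.\<close>

lemma dec_Ball: 
  assumes "tc g" "dec (\<lambda>z. P (pfst z) (psnd z))"
  shows "dec (\<lambda>x. \<forall>y<g x. P x y)"
proof -
  have "dec (\<lambda>x. (\<Sum>y<g x. of_bool (\<not> P x y)) = (0 :: nat))"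
    by (intro dec_eq tc_sum tc_const tc_of_bool dec_not assms)
  moreover have "(\<forall>y<g x. P x y) \<longleftrightarrow> (\<Sum>y<g x. of_bool (\<not> P x y)) = (0 :: nat)" for x
    by auto
  ultimately show ?thesis by (simp only:)
qed

lemma dec_Bex:
  assumes "tc g" "dec (\<lambda>z. P (pfst z) (psnd z))"
  shows "dec (\<lambda>x. \<exists>y<g x. P x y)"
proof -
  have "dec (\<lambda>x. \<not> (\<forall>y<g x. \<not> P x y))" by (intro dec_not dec_Ball assms)
  then show ?thesis by simp
qed

lemma dec_comp:
  assumes "dec P" "tc f"
  shows "dec (\<lambda>x. P (f x))"
  using tc_comp[OF tc_of_bool[OF assms(1)] assms(2)] unfolding dec_def .

text \<open>\<open>Mn\<close> looks for the value 0, so the program has to return the truth value of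
  the negation. As it is total, the search passes every failure.\<close>

lemma mn_search:
  assumes "\<And>y. evalr r (y # xs) (of_bool (\<not> P y))"
  shows "evalr (Mn r) xs n \<longleftrightarrow> P n \<and> (\<forall>m<n. \<not> P m)"
proof
  assume "evalr (Mn r) xs n"
  then have *: "evalr r (n # xs) 0" "\<forall>m<n. \<exists>y. evalr r (m # xs) (Suc y)"
    by (blast elim: evalr_MnE)+
  show "P n \<and> (\<forall>m<n. \<not> P m)"
    using evalr_deterministic[OF assms *(1)] evalr_deterministic[OF assms] *(2)
    by (fastforce split: if_splits simp: of_bool_def)
next
  assume *: "P n \<and> (\<forall>m<n. \<not> P m)"
  have "evalr r (m # xs) (Suc 0)" if "m < n" for m
    using assms[of m] * that by simp
  then show "evalr (Mn r) xs n"
    using assms[of n] * by (intro evalr.mn) auto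
qed

lemma tc_Least:
  assumes "dec (\<lambda>z. P (pfst z) (psnd z))" "\<And>x. \<exists>y. P x y"
  shows "tc (\<lambda>x. LEAST y. P x y)"
proof -
  \<comment> \<open>\<open>Mn\<close> puts the searched variable before the parameter, whereas the
    coded pairs have the parameter first.\<close>
  have swap: "ncomp 2 (\<lambda>xs. pair (xs ! 1) (xs ! 0))"
    by (intro tc2_ncomp[OF tc2_pair] ncomp_proj) auto
  have notP: "tc (\<lambda>z. of_bool (\<not> P (pfst z) (psnd z)))"
    by (rule tc_of_bool[OF dec_not[OF assms(1)]])
  have "ncomp 2 (\<lambda>xs. of_bool (\<not> P (xs ! 1) (xs ! 0)))"
    using tc_ncomp[OF notP swap]
    unfolding pfst_pair psnd_pair .
  then obtain r where r: "\<And>xs. length xs = 2 \<Longrightarrow> evalr r xs (of_bool (\<not> P (xs ! 1) (xs ! 0)))"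
    unfolding ncomp_def by blast
  have "evalr (Mn r) [x] (LEAST y. P x y)" for x
  proof -
    have "evalr r (y # [x]) (of_bool (\<not> P x y))" for y
      using r[of "[y, x]"] by simp
    from mn_search[of r "[x]" "P x", OF this] show ?thesis
      using LeastI_ex[OF assms(2), of x] not_less_Least[of _ "P x"] by blast
  qed
  then show ?thesis unfolding tc_def by blast
qed

lemma tc_div:
  assumes "tc f" "tc g"
  shows "tc (\<lambda>x. f x div g x)"
proof -
  \<comment> \<open>The first disjunct keeps the search total for divisor 0 and yields the HOL value
    \<open>m div 0 = 0\<close>.\<close>
  have ex: "\<exists>q. n = 0 \<and> q = 0 \<or> m < n * Suc q \<and> n \<noteq> 0" for m n :: nat
  proof (cases "n = 0")
    case False
    then have "m < n * Suc (m div n)" using dividend_less_times_div[of n m] by simp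
    then show ?thesis using False by blast
  qed simp
  have "tc (\<lambda>x. LEAST q. g x = 0 \<and> q = 0 \<or> f x < g x * Suc q \<and> g x \<noteq> 0)"
    by (rule tc_Least[OF _ ex])
      (intro dec_conj dec_disj dec_eq dec_less dec_not tc_mult tc_Suc tc_const tc_psnd tc_id
        tc_comp[OF assms(1) tc_pfst[OF tc_id]] tc_comp[OF assms(2) tc_pfst[OF tc_id]])
  moreover have "(LEAST q. n = 0 \<and> q = 0 \<or> m < n * Suc q \<and> n \<noteq> 0) = m div n" for m n :: nat
  proof (rule Least_equality)
    show "n = 0 \<and> m div n = 0 \<or> m < n * Suc (m div n) \<and> n \<noteq> 0"
      using dividend_less_times_div[of n m] by (cases "n = 0") simp_all
  next
    fix q assume "n = 0 \<and> q = 0 \<or> m < n * Suc q \<and> n \<noteq> 0"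
    then show "m div n \<le> q"
      using less_mult_imp_div_less[of m "Suc q" n] by (auto simp: mult.commute)
  qed
  ultimately show ?thesis by simp
qed

lemma tc_mod: "tc f \<Longrightarrow> tc g \<Longrightarrow> tc (\<lambda>x. f x mod g x)"
  unfolding modulo_nat_def by (intro tc_diff tc_mult tc_div)

lemmas tc_intros = tc_const tc_id tc_Suc tc_add tc_mult tc_diff tc_div tc_mod tc_power
  tc_pair tc_pfst tc_psnd tc_sum tc_of_bool
  dec_le dec_less dec_not dec_conj dec_disj dec_imp dec_eq dec_Ball dec_Bex

section \<open>Recursively enumerable predicates\<close>

lemma dec_comp2:
  assumes "dec (\<lambda>z. P (pfst z) (psnd z))" "tc f" "tc g"
  shows "dec (\<lambda>x. P (f x) (g x))"
  using dec_comp[OF assms(1) tc_pair[OF assms(2,3)]] by simp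

lemma tc_lift2:
  assumes "tc (\<lambda>z. h (pfst z) (psnd z))" "tc f" "tc g"
  shows "tc (\<lambda>x. h (f x) (g x))"
  using tc_comp[OF assms(1) tc_pair[OF assms(2,3)]] by simp

text \<open>Enumerability as projection of a decidable relation. The closure properties then reduce
  to merging witnesses \<open>t\<close> into one number.\<close>

definition re :: "(nat \<Rightarrow> bool) \<Rightarrow> bool" where
  "re P \<longleftrightarrow> (\<exists>Q. dec (\<lambda>z. Q (pfst z) (psnd z)) \<and> (\<forall>x. P x \<longleftrightarrow> (\<exists>t. Q x t)))"

lemma reI:
  assumes "dec (\<lambda>z. Q (pfst z) (psnd z))" "\<And>x. P x \<longleftrightarrow> (\<exists>t. Q x t)"
  shows "re P"
  using assms unfolding re_def by blast

lemma reD: "re P \<Longrightarrow> \<exists>Q. dec (\<lambda>z. Q (pfst z) (psnd z)) \<and> (\<forall>x. P x \<longleftrightarrow> (\<exists>t. Q x t))"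
  unfolding re_def .

lemma re_dec:
  assumes "dec P"
  shows "re P"
  by (rule reI[where Q="\<lambda>x t. P x"]) (auto intro: dec_comp[OF assms tc_pfst[OF tc_id]])

lemma re_comp:
  assumes "re P" "tc f"
  shows "re (\<lambda>x. P (f x))"
proof -
  obtain Q where Q: "dec (\<lambda>z. Q (pfst z) (psnd z))" "\<And>x. P x \<longleftrightarrow> (\<exists>t. Q x t)"
    using reD[OF assms(1)] by blast
  show ?thesis
    by (rule reI[where Q="\<lambda>x t. Q (f x) t"])
      (rule dec_comp2[OF Q(1) tc_comp[OF assms(2) tc_pfst[OF tc_id]] tc_psnd[OF tc_id]],
       rule Q(2))
qed

lemma re_comp2:
  assumes "re (\<lambda>z. P (pfst z) (psnd z))" "tc f" "tc g"
  shows "re (\<lambda>x. P (f x) (g x))"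
  using re_comp[OF assms(1) tc_pair[OF assms(2,3)]] by simp

lemma re_conj:
  assumes "re P" "re Q"
  shows "re (\<lambda>x. P x \<and> Q x)"
proof -
  obtain P' where P: "dec (\<lambda>z. P' (pfst z) (psnd z))" "\<And>x. P x \<longleftrightarrow> (\<exists>t. P' x t)"
    using reD[OF assms(1)] by blast
  obtain Q' where Q: "dec (\<lambda>z. Q' (pfst z) (psnd z))" "\<And>x. Q x \<longleftrightarrow> (\<exists>t. Q' x t)"
    using reD[OF assms(2)] by blast
  show ?thesis
  proof (rule reI[where Q="\<lambda>x t. P' x (pfst t) \<and> Q' x (psnd t)"])
    show "dec (\<lambda>z. P' (pfst z) (pfst (psnd z)) \<and> Q' (pfst z) (psnd (psnd z)))"
      by (intro dec_conj dec_comp2[OF P(1)] dec_comp2[OF Q(1)] tc_pfst tc_psnd tc_id)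
    show "P x \<and> Q x \<longleftrightarrow> (\<exists>t. P' x (pfst t) \<and> Q' x (psnd t))" for x
      unfolding P(2) Q(2) by (metis pfst_pair psnd_pair)
  qed
qed

lemma re_ex:
  assumes "re (\<lambda>z. P (pfst z) (psnd z))"
  shows "re (\<lambda>x. \<exists>y. P x y)"
proof -
  obtain Q where Q: "dec (\<lambda>z. Q (pfst z) (psnd z))" "\<And>z. P (pfst z) (psnd z) \<longleftrightarrow> (\<exists>t. Q z t)"
    using reD[OF assms] by blast
  show ?thesis
  proof (rule reI[where Q="\<lambda>x t. Q (pair x (pfst t)) (psnd t)"])
    show "dec (\<lambda>z. Q (pair (pfst z) (pfst (psnd z))) (psnd (psnd z)))"
      by (intro dec_comp2[OF Q(1)] tc_pair tc_pfst tc_psnd tc_id)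
    have "P x y \<longleftrightarrow> (\<exists>t. Q (pair x y) t)" for x y
      using Q(2)[of "pair x y"] by simp
    then show "(\<exists>y. P x y) \<longleftrightarrow> (\<exists>t. Q (pair x (pfst t)) (psnd t))" for x
      by (metis pfst_pair psnd_pair)
  qed
qed

text \<open>Finitely many witnesses have a common bound. This moves the unbounded quantifier outside
  the bounded one and leaves a decidable matrix.\<close>

lemma bounded_witness:
  fixes R :: "nat \<Rightarrow> nat \<Rightarrow> bool"
  shows "(\<forall>y<n. \<exists>t. R y t) \<longleftrightarrow> (\<exists>T. \<forall>y<n. \<exists>t<T. R y t)"
proof
  assume *: "\<forall>y<n. \<exists>t. R y t"
  then obtain t where t: "\<And>y. y < n \<Longrightarrow> R y (t y)" by metis
  have "t y < Suc (Max (t ` {..<n}))" if "y < n" for y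
    using that by (simp add: less_Suc_eq_le)
  with t show "\<exists>T. \<forall>y<n. \<exists>t<T. R y t" by blast
qed blast

lemma re_ball:
  assumes "tc g" "re (\<lambda>z. P (pfst z) (psnd z))"
  shows "re (\<lambda>x. \<forall>y<g x. P x y)"
proof -
  obtain Q where Q: "dec (\<lambda>z. Q (pfst z) (psnd z))" "\<And>z. P (pfst z) (psnd z) \<longleftrightarrow> (\<exists>t. Q z t)"
    using reD[OF assms(2)] by blast
  show ?thesis
  proof (rule reI[where Q="\<lambda>x T. \<forall>y<g x. \<exists>t<T. Q (pair x y) t"])
    show "dec (\<lambda>z. \<forall>y<g (pfst z). \<exists>t<psnd z. Q (pair (pfst z) y) t)"
      by (intro dec_Ball dec_Bex dec_comp2[OF Q(1)] tc_comp[OF assms(1) tc_pfst[OF tc_id]]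
          tc_pair tc_pfst tc_psnd tc_id)
    have "P x y \<longleftrightarrow> (\<exists>t. Q (pair x y) t)" for x y
      using Q(2)[of "pair x y"] by simp
    then show "(\<forall>y<g x. P x y) \<longleftrightarrow> (\<exists>T. \<forall>y<g x. \<exists>t<T. Q (pair x y) t)" for x
      using bounded_witness[of "g x" "\<lambda>y. Q (pair x y)"] by simp
  qed
qed

text \<open>Lists of numbers are coded by \<^const>\<open>list_encode\<close>; the empty list is coded by 0.\<close>

definition cons_code :: "nat \<Rightarrow> nat \<Rightarrow> nat" where "cons_code x c = Suc (pair x c)"
definition hd_code :: "nat \<Rightarrow> nat" where "hd_code c = pfst (c - 1)"
definition tl_code :: "nat \<Rightarrow> nat" where "tl_code c = psnd (c - 1)"
definition drop_code :: "nat \<Rightarrow> nat \<Rightarrow> nat" where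
  "drop_code c i = rec_nat c (\<lambda>_. tl_code) i"
definition nth_code :: "nat \<Rightarrow> nat \<Rightarrow> nat" where
  "nth_code c i = hd_code (drop_code c i)"

lemma tc_cons_code: "tc f \<Longrightarrow> tc g \<Longrightarrow> tc (\<lambda>x. cons_code (f x) (g x))"
  unfolding cons_code_def by (intro tc_Suc tc_pair)

lemma tc_hd_code: "tc f \<Longrightarrow> tc (\<lambda>x. hd_code (f x))"
  unfolding hd_code_def by (intro tc_pfst tc_diff tc_const)

lemma tc_tl_code: "tc f \<Longrightarrow> tc (\<lambda>x. tl_code (f x))"
  unfolding tl_code_def by (intro tc_psnd tc_diff tc_const)

lemma tc_drop_code: "tc f \<Longrightarrow> tc g \<Longrightarrow> tc (\<lambda>x. drop_code (f x) (g x))"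
  unfolding drop_code_def by (intro tc_rec tc_tl_code tc_psnd tc_id)

lemma tc_nth_code: "tc f \<Longrightarrow> tc g \<Longrightarrow> tc (\<lambda>x. nth_code (f x) (g x))"
  unfolding nth_code_def by (intro tc_hd_code tc_drop_code)

lemma list_decode_cons_code [simp]: "list_decode (cons_code x c) = x # list_decode c"
  by (simp add: cons_code_def pair_def)

lemma list_decode_nonzero: "c \<noteq> 0 \<Longrightarrow> list_decode c = hd_code c # list_decode (tl_code c)"
  by (cases c) (simp_all add: hd_code_def tl_code_def pfst_def psnd_def split: prod.splits)

lemma list_decode_tl_code: "list_decode (tl_code c) = tl (list_decode c)"
proof (cases "c = 0")
  case True
  have "psnd 0 = 0" using psnd_pair[of 0 0] by (simp add: pair_def prod_encode_def)
  then show ?thesis using True by (simp add: tl_code_def)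
qed (simp add: list_decode_nonzero)

lemma list_decode_drop_code: "list_decode (drop_code c i) = drop i (list_decode c)"
proof (induction i)
  case (Suc i)
  then show ?case by (simp add: drop_code_def list_decode_tl_code drop_Suc drop_tl)
qed (simp add: drop_code_def)

lemma list_decode_Nil_iff: "list_decode c = [] \<longleftrightarrow> c = 0"
  using list_decode_nonzero[of c] by (cases "c = 0") auto

lemma drop_code_nonzero_iff: "drop_code c i \<noteq> 0 \<longleftrightarrow> i < length (list_decode c)"
  using list_decode_Nil_iff[of "drop_code c i"] by (auto simp: list_decode_drop_code)

lemma nth_code_eq: "i < length (list_decode c) \<Longrightarrow> nth_code c i = list_decode c ! i"
  using drop_code_nonzero_iff[of c i] list_decode_nonzero[of "drop_code c i"]
  by (simp add: nth_code_def list_decode_drop_code flip: hd_drop_conv_nth)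

text \<open>Lets one number stand for any finite sequence: histories of recursions, tables of
  shifts, lists of distinct elements.\<close>

lemma nth_code_exists: "\<exists>c. \<forall>i<n. nth_code c i = f i"
proof -
  have "nth_code (list_encode (map f [0..<n])) i = f i" if "i < n" for i
    using nth_code_eq[of i "list_encode (map f [0..<n])"] that by simp
  then show ?thesis by blast
qed

section \<open>Evaluation of a fixed program is enumerable\<close>

lemma evalr_Zero_iff: "evalr Zero xs y \<longleftrightarrow> y = 0"
  by (auto intro: evalr.zero elim: evalr_ZeroE)

lemma evalr_Succ_iff: "evalr Succ xs y \<longleftrightarrow> xs \<noteq> [] \<and> y = Suc (hd xs)"
  by (cases xs) (auto intro: evalr.succ elim: evalr_SuccE)

lemma evalr_Proj_iff: "evalr (Proj i) xs y \<longleftrightarrow> i < length xs \<and> y = xs ! i"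
  by (auto intro: evalr.proj elim: evalr_ProjE)

lemma evalr_Comp_iff:
  "evalr (Comp f gs) xs z \<longleftrightarrow> (\<exists>ys. list_all2 (\<lambda>g y. evalr g xs y) gs ys \<and> evalr f ys z)"
  by (blast intro: evalr.comp elim: evalr_CompE)

lemma evalr_Prim_iff:
  "evalr (Prim f g) (n # xs) z \<longleftrightarrow>
    (\<exists>s. evalr f xs (s 0) \<and> (\<forall>m<n. evalr g (s m # m # xs) (s (Suc m))) \<and> s n = z)"
proof
  show "evalr (Prim f g) (n # xs) z \<Longrightarrow>
    \<exists>s. evalr f xs (s 0) \<and> (\<forall>m<n. evalr g (s m # m # xs) (s (Suc m))) \<and> s n = z"
  proof (induction n arbitrary: z)
    case 0
    then have "evalr f xs z" by (rule evalr_Prim0E)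
    then show ?case by (intro exI[of _ "\<lambda>_. z"]) simp
  next
    case (Suc n)
    from Suc.prems obtain y where y: "evalr (Prim f g) (n # xs) y" "evalr g (y # n # xs) z"
      by (rule evalr_PrimSucE)
    from Suc.IH[OF y(1)] obtain s where
      "evalr f xs (s 0)" "\<forall>m<n. evalr g (s m # m # xs) (s (Suc m))" "s n = y" by blast
    with y(2) show ?case by (intro exI[of _ "s(Suc n := z)"]) (auto simp: less_Suc_eq)
  qed
next
  show "\<exists>s. evalr f xs (s 0) \<and> (\<forall>m<n. evalr g (s m # m # xs) (s (Suc m))) \<and> s n = z
    \<Longrightarrow> evalr (Prim f g) (n # xs) z"
  proof (induction n arbitrary: z)
    case 0
    then show ?case by (auto intro: evalr.prim0)
  next
    case (Suc n)
    then show ?case by (metis evalr.primS lessI less_SucI)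
  qed
qed

text \<open>The history of intermediate values becomes a number, so that the existential quantifier
  is one that \<open>re_ex\<close> can treat.\<close>

lemma evalr_Prim_code_iff:
  "evalr (Prim f g) (n # xs) z \<longleftrightarrow>
    (\<exists>c. evalr f xs (nth_code c 0) \<and>
      (\<forall>m<n. evalr g (nth_code c m # m # xs) (nth_code c (Suc m))) \<and> nth_code c n = z)"
proof
  assume "evalr (Prim f g) (n # xs) z"
  then obtain s where s: "evalr f xs (s 0)" "\<forall>m<n. evalr g (s m # m # xs) (s (Suc m))" "s n = z"
    unfolding evalr_Prim_iff by blast
  obtain c where "\<forall>i<Suc n. nth_code c i = s i" using nth_code_exists by blast
  with s show "\<exists>c. evalr f xs (nth_code c 0) \<and>
      (\<forall>m<n. evalr g (nth_code c m # m # xs) (nth_code c (Suc m))) \<and> nth_code c n = z"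
    by (intro exI[of _ c]) simp
qed (auto simp: evalr_Prim_iff)

lemma evalr_Prim_Nil: "\<not> evalr (Prim f g) [] z"
  by (auto elim: evalr_PrimE)

lemma evalr_Mn_iff:
  "evalr (Mn f) xs n \<longleftrightarrow> evalr f (n # xs) 0 \<and> (\<forall>m<n. \<exists>y. evalr f (m # xs) (Suc y))"
  by (blast intro: evalr.mn elim: evalr_MnE)

text \<open>Induction on the program: composition guesses the list of intermediate values, primitive
  recursion guesses a coded history, and minimisation is a bounded quantifier over the smaller
  arguments.\<close>

theorem re_evalr: "re (\<lambda>z. evalr f (list_decode (pfst z)) (psnd z))"
proof (induction f)
  case Zero
  show ?case unfolding evalr_Zero_iff by (intro re_dec dec_eq tc_psnd tc_id tc_const)
next
  case Succ
  have "evalr Succ (list_decode c) y \<longleftrightarrow> c \<noteq> 0 \<and> y = Suc (hd_code c)" for c y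
    by (cases "c = 0") (auto simp: evalr_Succ_iff list_decode_nonzero)
  then show ?case
    by (simp only:) (intro re_dec dec_conj dec_not dec_eq tc_Suc tc_hd_code tc_pfst tc_psnd tc_id
        tc_const)
next
  case (Proj i)
  have "evalr (Proj i) (list_decode c) y \<longleftrightarrow> drop_code c i \<noteq> 0 \<and> y = nth_code c i" for c y
    unfolding drop_code_nonzero_iff by (auto simp: evalr_Proj_iff nth_code_eq)
  then show ?case
    by (simp only:) (intro re_dec dec_conj dec_not dec_eq tc_drop_code tc_nth_code tc_pfst tc_psnd
        tc_id tc_const)
next
  case (Comp f gs)
  have args: "re (\<lambda>z. list_all2 (\<lambda>g y. evalr g (list_decode (pfst z)) y) gs (list_decode (psnd z)))"
    using Comp.IH(2)
  proof (induction gs)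
    case Nil
    have "list_all2 (\<lambda>g y. evalr g xs y) [] (list_decode c) \<longleftrightarrow> c = 0" for xs c
      by (simp add: list_decode_Nil_iff)
    then show ?case by (simp only:) (intro re_dec dec_eq tc_psnd tc_id tc_const)
  next
    case (Cons g gs)
    have "list_all2 (\<lambda>g y. evalr g xs y) (g # gs) (list_decode c) \<longleftrightarrow>
      c \<noteq> 0 \<and> evalr g xs (hd_code c) \<and> list_all2 (\<lambda>g y. evalr g xs y) gs (list_decode (tl_code c))"
      for xs c
      by (cases "c = 0") (auto simp: list_decode_nonzero)
    moreover have hd: "re (\<lambda>z. evalr g (list_decode (pfst z)) (psnd z))"
      using Cons.prems by simp
    moreover have tl: "re (\<lambda>z. list_all2 (\<lambda>g y. evalr g (list_decode (pfst z)) y) gs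
        (list_decode (psnd z)))"
      using Cons.prems by (intro Cons.IH) simp
    ultimately show ?case
      by (simp only:) (intro re_conj re_dec dec_not dec_eq tc_const tc_psnd tc_pfst tc_id
          tc_hd_code tc_tl_code
          re_comp2[of "\<lambda>c y. evalr g (list_decode c) y", OF hd]
          re_comp2[of "\<lambda>c d. list_all2 (\<lambda>g y. evalr g (list_decode c) y) gs (list_decode d)", OF tl])
  qed
  have "evalr (Comp f gs) xs z \<longleftrightarrow>
      (\<exists>d. list_all2 (\<lambda>g y. evalr g xs y) gs (list_decode d) \<and> evalr f (list_decode d) z)" for xs z
    unfolding evalr_Comp_iff by (metis list_encode_inverse)
  then show ?case
    by (simp only:) (intro re_ex re_conj tc_psnd tc_pfst tc_id
       re_comp2[OF args] re_comp2[of "\<lambda>c y. evalr f (list_decode c) y", OF Comp.IH(1)])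
next
  case (Prim f g)
  have "evalr (Prim f g) (list_decode c) z \<longleftrightarrow> c \<noteq> 0 \<and>
    (\<exists>s. evalr f (list_decode (tl_code c)) (nth_code s 0) \<and>
      (\<forall>m<hd_code c. evalr g (list_decode (cons_code (nth_code s m) (cons_code m (tl_code c))))
        (nth_code s (Suc m))) \<and> nth_code s (hd_code c) = z)" for c z
    by (cases "c = 0") (simp_all add: evalr_Prim_Nil list_decode_nonzero evalr_Prim_code_iff)
  then show ?case
    by (simp only:) (intro re_ex re_conj re_dec re_ball dec_not dec_eq tc_cons_code tc_nth_code
       tc_hd_code tc_tl_code tc_Suc tc_psnd tc_pfst tc_id tc_const
       re_comp2[of "\<lambda>c y. evalr f (list_decode c) y", OF Prim.IH(1)]
       re_comp2[of "\<lambda>c y. evalr g (list_decode c) y", OF Prim.IH(2)])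
next
  case (Mn f)
  have "evalr (Mn f) (list_decode c) n \<longleftrightarrow> evalr f (list_decode (cons_code n c)) 0 \<and>
      (\<forall>m<n. \<exists>y. evalr f (list_decode (cons_code m c)) (Suc y))" for c n
    by (simp add: evalr_Mn_iff)
  then show ?case
    by (simp only:) (intro re_ex re_conj re_ball tc_cons_code tc_Suc tc_psnd tc_pfst tc_id tc_const
       re_comp2[of "\<lambda>c y. evalr f (list_decode c) y", OF Mn.IH])
qed

lemma re_evalr2:
  assumes "\<And>p v u. evalr f [p, v] u \<longleftrightarrow> G p v u" "tc p" "tc v" "tc u"
  shows "re (\<lambda>x. G (p x) (v x) (u x))"
proof -
  have "G p v u \<longleftrightarrow> evalr f (list_decode (cons_code p (cons_code v 0))) u" for p v u
    using assms(1) by simp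
  then show ?thesis
    by (simp only:) (intro re_comp2[of "\<lambda>c y. evalr f (list_decode c) y", OF re_evalr]
        tc_cons_code tc_const assms(2-4))
qed

text \<open>The program searches for the first pair of an output and a witness and returns the
  output. Functionality ensures that the first success carries the intended output.\<close>

lemma evalr_of_re:
  assumes re: "re (\<lambda>z. G (pfst z) (pfst (psnd z)) (psnd (psnd z)))"
    and functional: "\<And>p v u u'. G p v u \<Longrightarrow> G p v u' \<Longrightarrow> u = u'"
  shows "\<exists>f. \<forall>p v u. evalr f [p, v] u \<longleftrightarrow> G p v u"
proof -
  obtain Q where Q: "dec (\<lambda>z. Q (pfst z) (psnd z))"
    and GQ: "\<And>z. G (pfst z) (pfst (psnd z)) (psnd (psnd z)) \<longleftrightarrow> (\<exists>t. Q z t)"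
    using reD[OF re] by blast
  define S where "S p v w \<longleftrightarrow> Q (pair p (pair v (pfst w))) (psnd w)" for p v w
  have GS: "G p v u \<longleftrightarrow> (\<exists>t. S p v (pair u t))" for p v u
    using GQ[of "pair p (pair v u)"] by (simp add: S_def)
  have "tc (\<lambda>z. of_bool (\<not> S (pfst z) (pfst (psnd z)) (psnd (psnd z))))"
    unfolding S_def by (intro tc_of_bool dec_not dec_comp2[OF Q] tc_pair tc_pfst tc_psnd tc_id)
  moreover have "ncomp 3 (\<lambda>xs. pair (xs ! 1) (pair (xs ! 2) (xs ! 0)))"
    by (intro tc2_ncomp[OF tc2_pair] ncomp_proj; simp)
  ultimately have "ncomp 3 (\<lambda>xs. of_bool (\<not> S (xs ! 1) (xs ! 2) (xs ! 0)))"
    using tc_ncomp[of "\<lambda>z. of_bool (\<not> S (pfst z) (pfst (psnd z)) (psnd (psnd z)))" 3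
        "\<lambda>xs. pair (xs ! 1) (pair (xs ! 2) (xs ! 0))"] by simp
  then obtain r where r: "\<And>xs. length xs = 3 \<Longrightarrow> evalr r xs (of_bool (\<not> S (xs ! 1) (xs ! 2) (xs ! 0)))"
    unfolding ncomp_def by blast
  obtain s where s: "\<And>x. evalr s [x] (pfst x)"
    using tc_pfst[OF tc_id] unfolding tc_def by blast
  have search: "evalr (Mn r) [p, v] w \<longleftrightarrow> S p v w \<and> (\<forall>w'<w. \<not> S p v w')" for p v w
  proof (rule mn_search)
    show "evalr r (y # [p, v]) (of_bool (\<not> S p v y))" for y
      using r[of "[y, p, v]"] by (simp add: numeral_2_eq_2)
  qed
  have "evalr (Comp s [Mn r]) [p, v] u \<longleftrightarrow> G p v u" for p v u
  proof
    assume "evalr (Comp s [Mn r]) [p, v] u"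
    then obtain w where w: "evalr (Mn r) [p, v] w" "evalr s [w] u"
      unfolding evalr_Comp_iff by (auto simp: list_all2_Cons1)
    have "u = pfst w" using w(2) s evalr_deterministic by blast
    then show "G p v u" using w(1) GS[of p v u] pair_pfst_psnd[of w] unfolding search by metis
  next
    assume "G p v u"
    then obtain t where "S p v (pair u t)" using GS by blast
    then obtain w where w: "S p v w" "\<forall>w'<w. \<not> S p v w'"
      using exists_least_iff[of "S p v"] by blast
    have "G p v (pfst w)" using GS[of p v "pfst w"] w(1) pair_pfst_psnd[of w] by metis
    then have "pfst w = u" using functional \<open>G p v u\<close> by blast
    then show "evalr (Comp s [Mn r]) [p, v] u"
      using w s[of w] search[of p v w] unfolding evalr_Comp_iff
      by (intro exI[of _ "[w]"]) simp
  qed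
  then show ?thesis by blast
qed

section \<open>Binary strings as numbers\<close>

lemma bij_nat_of_str: "bij nat_of_str"
proof (rule bijI)
  show "inj nat_of_str"
  proof (rule injI)
    show "nat_of_str s = nat_of_str t \<Longrightarrow> s = t" for s t
    proof (induction s arbitrary: t)
      case Nil
      then show ?case by (cases t) (auto split: if_splits)
    next
      case (Cons b s)
      obtain b' t' where t: "t = b' # t'" using Cons.prems by (cases t) (auto split: if_splits)
      have "2 * nat_of_str s + (if b then 2 else 1) = 2 * nat_of_str t' + (if b' then 2 else 1)"
        using Cons.prems t by simp
      then have "b = b' \<and> nat_of_str s = nat_of_str t'" by (cases b; cases b'; simp; presburger)
      then show ?case using Cons.IH t by blast
    qed
  qed
  have "\<exists>s. nat_of_str s = n" for n
  proof (induction n rule: less_induct)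
    case (less n)
    consider "n = 0" | m where "n = 2 * m + 1" | m where "n = 2 * m + 2"
      by (metis add_2_eq_Suc' evenE mult_Suc_right not0_implies_Suc oddE add_Suc_right One_nat_def
          add.right_neutral even_Suc)
    then show ?case
    proof cases
      case 1
      then show ?thesis using nat_of_str.simps(1) by blast
    next
      case (2 m)
      then obtain s where "nat_of_str s = m" using less.IH[of m] by auto
      then have "nat_of_str (False # s) = n" using 2 by simp
      then show ?thesis by blast
    next
      case (3 m)
      then obtain s where "nat_of_str s = m" using less.IH[of m] by auto
      then have "nat_of_str (True # s) = n" using 3 by simp
      then show ?thesis by blast
    qed
  qed
  then show "surj nat_of_str" by (metis surjI)
qed

definition str :: "nat \<Rightarrow> bool list" where "str = inv nat_of_str"

lemma str_nat_of_str [simp]: "str (nat_of_str s) = s"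
  unfolding str_def using bij_nat_of_str by (simp add: bij_is_inj)

lemma nat_of_str_str [simp]: "nat_of_str (str n) = n"
  unfolding str_def using bij_nat_of_str by (simp add: bij_is_surj surj_f_inv_f)

lemma str_eq_iff: "str m = str n \<longleftrightarrow> m = n"
  by (metis nat_of_str_str)

text \<open>In binary, \<open>nat_of_str s + 1\<close> consists of the digits of \<open>s\<close>,
  least significant first, below a leading 1.\<close>

lemma nat_of_str_bounds: "2 ^ length s \<le> nat_of_str s + 1 \<and> nat_of_str s + 1 < 2 ^ (length s + 1)"
  by (induction s) auto

section \<open>Lengths of coded strings\<close>

definition len :: "nat \<Rightarrow> nat" where "len n = length (str n)"

lemma len_lower: "2 ^ len n \<le> n + 1" and len_upper: "n + 1 < 2 ^ (len n + 1)"
  using nat_of_str_bounds[of "str n"] by (simp_all add: len_def)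

lemma len_le_iff: "len n \<le> k \<longleftrightarrow> n + 1 < 2 ^ (k + 1)"
proof
  assume "len n \<le> k"
  then have "(2::nat) ^ (len n + 1) \<le> 2 ^ (k + 1)" by (intro power_increasing) auto
  then show "n + 1 < 2 ^ (k + 1)" using len_upper[of n] by linarith
next
  assume "n + 1 < 2 ^ (k + 1)"
  then have "(2::nat) ^ len n < 2 ^ (k + 1)" using len_lower[of n] by linarith
  then show "len n \<le> k" using power_less_imp_less_exp[of "2::nat" "len n" "k + 1"] by simp
qed

lemma len_less_iff: "len n < k \<longleftrightarrow> n + 1 < 2 ^ k"
  using len_le_iff[of n "k - 1"] by (cases k) auto

lemma len_eq_iff: "len n = k \<longleftrightarrow> 2 ^ k \<le> n + 1 \<and> n + 1 < 2 ^ (k + 1)"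
  using len_le_iff[of n k] len_less_iff[of n k] by linarith

lemma len_mono: "m \<le> n \<Longrightarrow> len m \<le> len n"
  using len_le_iff[of m "len n"] len_upper[of n] by simp

lemma len_0 [simp]: "len 0 = 0"
  by (simp add: len_eq_iff)

lemma len_less_set: "{n. len n < k} = {..<2 ^ k - 1}"
  by (auto simp: len_less_iff)

lemma len_eq_set: "{n. len n = k} = {2 ^ k - 1..<2 ^ (k + 1) - 1}"
  by (auto simp: len_eq_iff)

lemma finite_len_eq [simp]: "finite {n. len n = k}"
  and card_len_eq [simp]: "card {n. len n = k} = 2 ^ k"
  by (simp_all add: len_eq_set)

lemma finite_len_less [simp]: "finite {n. len n < k}"
  and card_len_less: "card {n. len n < k} \<le> 2 ^ k"
  by (simp_all add: len_less_set)

lemma tc_len: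
  assumes "tc f"
  shows "tc (\<lambda>x. len (f x))"
proof -
  have "tc (\<lambda>x. LEAST k. x + 1 < 2 ^ (k + 1))"
  proof (rule tc_Least)
    show "dec (\<lambda>z. pfst z + 1 < 2 ^ (psnd z + 1))"
      by (intro tc_intros)
    show "\<exists>y. x + 1 < 2 ^ (y + 1)" for x :: nat using len_upper by blast
  qed
  moreover have "(LEAST k. n + 1 < 2 ^ (k + 1)) = len n" for n
    unfolding len_le_iff[symmetric] by (rule Least_equality) auto
  ultimately show ?thesis using tc_comp[OF _ assms, of len] by simp
qed

section \<open>Coded pairs of strings\<close>

definition spair :: "nat \<Rightarrow> nat \<Rightarrow> nat" where
  "spair u v = nat_of_str (pair_str (str u) (str v))"

lemma pair_str_Nil: "pair_str [] v = False # True # v"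
  and pair_str_Cons: "pair_str (b # u) v = b # b # pair_str u v"
  by (simp_all add: pair_str_def)

lemma pair_str_inject: "pair_str u v = pair_str u' v' \<longleftrightarrow> u = u' \<and> v = v'"
proof (induction u arbitrary: u')
  case Nil
  then show ?case by (cases u') (auto simp: pair_str_Nil pair_str_Cons)
next
  case (Cons b u)
  then show ?case by (cases u') (auto simp: pair_str_Nil pair_str_Cons)
qed

lemma spair_inject [simp]: "spair u v = spair u' v' \<longleftrightarrow> u = u' \<and> v = v'"
  unfolding spair_def using bij_nat_of_str
  by (simp add: bij_is_inj inj_eq pair_str_inject str_eq_iff)

lemma length_pair_str: "length (pair_str u v) = 2 * length u + 2 + length v"
  by (induction u) (auto simp: pair_str_Nil pair_str_Cons)

lemma len_spair: "len (spair u v) = 2 * len u + 2 + len v"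
  by (simp add: spair_def len_def length_pair_str)

text \<open>The digit \<open>i\<close> of a string coded by \<open>n\<close> is the binary digit \<open>i\<close> of \<open>n + 1\<close>; a doubled digit
  has weight \<open>3 * 4 ^ i\<close>.\<close>

lemma nat_of_str_pair_str:
  "nat_of_str (pair_str s t) =
    (\<Sum>i<length s. 3 * 4 ^ i * (1 + (nat_of_str s + 1) div 2 ^ i mod 2)) +
    4 ^ length s * (5 + 4 * nat_of_str t)"
proof (induction s)
  case Nil
  show ?case by (simp add: pair_str_Nil)
next
  case (Cons b s)
  define n where "n = nat_of_str (b # s) + 1"
  have n: "n = 2 * (nat_of_str s + 1) + of_bool b" by (simp add: n_def)
  have "n div 2 = nat_of_str s + 1" unfolding n by (cases b) auto
  then have shift: "n div 2 ^ Suc i = (nat_of_str s + 1) div 2 ^ i" for i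
    by (simp add: div_mult2_eq)
  have "n mod 2 = of_bool b" unfolding n by (cases b) auto
  then have "(\<Sum>i<length (b # s). 3 * 4 ^ i * (1 + n div 2 ^ i mod 2)) =
      3 * (1 + of_bool b) + 4 * (\<Sum>i<length s. 3 * 4 ^ i * (1 + (nat_of_str s + 1) div 2 ^ i mod 2))"
    unfolding length_Cons sum.lessThan_Suc_shift shift
    by (simp add: sum_distrib_left algebra_simps)
  moreover have "nat_of_str (pair_str (b # s) t) = 3 * (1 + of_bool b) + 4 * nat_of_str (pair_str s t)"
    by (simp add: pair_str_Cons)
  ultimately show ?case unfolding Cons.IH n_def by (simp add: algebra_simps)
qed

text \<open>A closed arithmetic expression, from which computability can be read off.\<close>

lemma spair_eq:
  "spair u v = (\<Sum>i<len u. 3 * 4 ^ i * (1 + (u + 1) div 2 ^ i mod 2)) + 4 ^ len u * (5 + 4 * v)"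
  by (simp add: spair_def nat_of_str_pair_str len_def)

lemma tc_spair:
  assumes "tc f" "tc g"
  shows "tc (\<lambda>x. spair (f x) (g x))"
proof (rule tc_lift2[OF _ assms, of spair])
  show "tc (\<lambda>z. spair (pfst z) (psnd z))"
    unfolding spair_eq by (intro tc_intros tc_len)
qed

lemma pair_less: "pair x y < (x + y + 1) ^ 2"
proof -
  have "2 * triangle (x + y) = (x + y) * (x + y + 1)" by (simp add: triangle_def)
  then show ?thesis by (simp add: pair_def prod_encode_def power2_eq_square algebra_simps)
qed

text \<open>The factor 2 reflects the quadratic growth of the pairing. It is harmless, since later
  only numbers of logarithmic length are paired in this way.\<close>

lemma len_pair: "len (pair x y) \<le> 2 * (len x + len y) + 4"
proof -
  have "x + y + 1 \<le> 2 ^ (len x + 1) + 2 ^ (len y + 1)"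
    using len_upper[of x] len_upper[of y] by linarith
  also have "\<dots> \<le> 2 ^ (len x + len y + 1) + 2 ^ (len x + len y + 1)"
    by (intro add_mono power_increasing) auto
  also have "\<dots> = 2 ^ (len x + len y + 2)" by simp
  finally have "(x + y + 1) ^ 2 \<le> (2 ^ (len x + len y + 2)) ^ 2" by (rule power_mono) simp
  also have "\<dots> = 2 ^ (2 * (len x + len y) + 4)" by (simp add: power_add power_mult power_mult_distrib mult.commute)
  finally have "pair x y < 2 ^ (2 * (len x + len y) + 4)"
    using pair_less[of x y] by linarith
  then have "pair x y + 1 < 2 ^ (2 * (len x + len y) + 4 + 1)"
    unfolding power_add[of 2 _ 1] power_one_right by linarith
  then show ?thesis unfolding len_le_iff .
qed

section \<open>Complexity and enumeration\<close>

locale optimal_language =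
  fixes D :: "bool list \<Rightarrow> bool list \<Rightarrow> bool list option"
  assumes optimal: "optimal_lang D"
begin

definition runs :: "nat \<Rightarrow> nat \<Rightarrow> nat \<Rightarrow> bool" where
  "runs p v u \<longleftrightarrow> D (str p) (str v) = Some (str u)"

text \<open>The number 0 codes the empty string, so \<open>K u 0\<close> is the plain
  complexity.\<close>

definition K :: "nat \<Rightarrow> nat \<Rightarrow> nat" where
  "K u v = KSc D (str u) (str v)"

lemma re_runs:
  assumes "tc p" "tc v" "tc u"
  shows "re (\<lambda>x. runs (p x) (v x) (u x))"
proof -
  obtain f where f: "\<And>p v u. evalr f [nat_of_str p, nat_of_str v] (nat_of_str u) \<longleftrightarrow> D p v = Some u"
    using optimal unfolding optimal_lang_def computable2_def by blast
  have "evalr f [p, v] u \<longleftrightarrow> runs p v u" for p v u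
    using f[of "str p" "str v" "str u"] by (simp add: runs_def)
  then show ?thesis using assms by (rule re_evalr2)
qed

lemma runs_functional: "runs p v u \<Longrightarrow> runs p v u' \<Longrightarrow> u = u'"
  by (simp add: runs_def str_eq_iff)

text \<open>An enumerable functional relation is the graph of a programming language, with which the
  optimal one is compared.\<close>

lemma optimal_program:
  assumes re: "re (\<lambda>z. G (pfst z) (pfst (psnd z)) (psnd (psnd z)))"
    and functional: "\<And>p v u u'. G p v u \<Longrightarrow> G p v u' \<Longrightarrow> u = u'"
  shows "\<exists>c. \<forall>p v u. G p v u \<longrightarrow> (\<exists>p'. runs p' v u \<and> len p' \<le> len p + c)"
proof -
  define D' where "D' p v = (if \<exists>u. G (nat_of_str p) (nat_of_str v) u
    then Some (str (THE u. G (nat_of_str p) (nat_of_str v) u)) else None)" for p v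
  have D': "D' p v = Some u \<longleftrightarrow> G (nat_of_str p) (nat_of_str v) (nat_of_str u)" for p v u
  proof (cases "\<exists>u. G (nat_of_str p) (nat_of_str v) u")
    case True
    then obtain w where w: "G (nat_of_str p) (nat_of_str v) w" by blast
    then have "(THE u. G (nat_of_str p) (nat_of_str v) u) = w"
      using functional by (blast intro: the_equality)
    then have "D' p v = Some (str w)" using True by (simp add: D'_def)
    then show ?thesis using w functional by (metis nat_of_str_str option.inject str_nat_of_str)
  qed (simp add: D'_def)
  have "\<exists>f. \<forall>p v u. evalr f [p, v] u \<longleftrightarrow> G p v u"
    by (rule evalr_of_re[OF re]) (rule functional)
  then obtain f where f: "\<forall>p v u. evalr f [p, v] u \<longleftrightarrow> G p v u" ..
  have "computable2 D'" unfolding computable2_def D' using f by (intro exI[of _ f]) simp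
  then obtain c where c: "\<And>p v u. D' p v = Some u \<Longrightarrow>
      \<exists>p'. D p' v = Some u \<and> length p' \<le> length p + c"
    using optimal unfolding optimal_lang_def by blast
  have "\<exists>p'. runs p' v u \<and> len p' \<le> len p + c" if "G p v u" for p v u
  proof -
    have "D' (str p) (str v) = Some (str u)" using that by (simp add: D')
    then obtain p' where "D p' (str v) = Some (str u)" "length p' \<le> length (str p) + c"
      using c by blast
    then show ?thesis by (intro exI[of _ "nat_of_str p'"]) (simp add: runs_def len_def)
  qed
  then show ?thesis by blast
qed

lemma K_eq: "K u v = (LEAST n. \<exists>p. len p = n \<and> runs p v u)"
proof -
  have "(\<exists>p. length p = n \<and> D p (str v) = Some (str u)) \<longleftrightarrow> (\<exists>p. len p = n \<and> runs p v u)" for n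
    unfolding len_def runs_def by (metis str_nat_of_str)
  then show ?thesis by (simp add: K_def KSc_def)
qed

lemma K_le: "runs p v u \<Longrightarrow> K u v \<le> len p"
  unfolding K_eq by (rule Least_le) blast

text \<open>Comparison with the language in which every program prints itself shows that programs
  exist, so the \<open>LEAST\<close> in \<open>K_eq\<close> is attained.\<close>

lemma K_program: "\<exists>p. len p = K u v \<and> runs p v u"
proof -
  have "re (\<lambda>z. psnd (psnd z) = pfst z)" by (intro re_dec tc_intros)
  from optimal_program[of "\<lambda>p v u. u = p", OF this] obtain p where "runs p v u"
    by blast
  then have "\<exists>n p. len p = n \<and> runs p v u" by blast
  then show ?thesis unfolding K_eq by (rule LeastI_ex)
qed

lemma K_bound:
  assumes "re (\<lambda>z. G (pfst z) (pfst (psnd z)) (psnd (psnd z)))"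
    and "\<And>p v u u'. G p v u \<Longrightarrow> G p v u' \<Longrightarrow> u = u'"
  shows "\<exists>c. \<forall>p v u. G p v u \<longrightarrow> K u v \<le> len p + c"
proof -
  have "\<exists>c. \<forall>p v u. G p v u \<longrightarrow> (\<exists>p'. runs p' v u \<and> len p' \<le> len p + c)"
    by (rule optimal_program[OF assms(1)]) (rule assms(2))
  then show ?thesis using K_le order_trans by meson
qed

lemma K_le_len: "\<exists>c. \<forall>u v. K u v \<le> len u + c"
proof -
  have "re (\<lambda>z. psnd (psnd z) = pfst z)" by (intro re_dec tc_intros)
  from K_bound[of "\<lambda>p v u. u = p", OF this] show ?thesis by blast
qed

text \<open>The canonical witness of \<open>Q w v u\<close> is its first one; \<open>u\<close> is then described by \<open>w\<close> and the
  number of canonical pairs that precede its own.\<close>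

lemma K_enumeration:
  assumes "re (\<lambda>z. Q (pfst z) (pfst (psnd z)) (psnd (psnd z)))"
  shows "\<exists>c. \<forall>w v u n. Q w v u \<longrightarrow> finite {u. Q w v u} \<longrightarrow> card {u. Q w v u} \<le> 2 ^ n \<longrightarrow>
    K u v \<le> n + 2 * len w + c"
proof -
  obtain R where R: "dec (\<lambda>z. R (pfst z) (psnd z))"
    and QR: "\<And>z. Q (pfst z) (pfst (psnd z)) (psnd (psnd z)) \<longleftrightarrow> (\<exists>t. R z t)"
    using reD[OF assms] by blast
  \<comment> \<open>A canonical code \<open>e\<close> pairs an output with its least witness, so
    each output has exactly one code and counting codes counts outputs.\<close>
  define T where "T w v e \<longleftrightarrow> R (pair w (pair v (pfst e))) (psnd e) \<and>
    (\<forall>t<psnd e. \<not> R (pair w (pair v (pfst e))) t)" for w v e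
  have QT: "Q w v u \<longleftrightarrow> (\<exists>e. T w v e \<and> pfst e = u)" for w v u
  proof
    assume "Q w v u"
    then have "\<exists>t. R (pair w (pair v u)) t" using QR[of "pair w (pair v u)"] by simp
    then obtain t where "R (pair w (pair v u)) t" "\<forall>t'<t. \<not> R (pair w (pair v u)) t'"
      using exists_least_iff[of "R (pair w (pair v u))"] by blast
    then show "\<exists>e. T w v e \<and> pfst e = u" by (intro exI[of _ "pair u t"]) (simp add: T_def)
  next
    assume "\<exists>e. T w v e \<and> pfst e = u"
    then show "Q w v u" using QR[of "pair w (pair v u)"] by (auto simp: T_def)
  qed
  have T_inj: "inj_on pfst {e. T w v e}" for w v
  proof (rule inj_onI)
    fix e e' assume *: "e \<in> {e. T w v e}" "e' \<in> {e. T w v e}" "pfst e = pfst e'"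
    then have "psnd e = psnd e'"
      by (rule_tac linorder_cases[of "psnd e" "psnd e'"]) (auto simp: T_def)
    then show "e = e'" using * by (metis pair_pfst_psnd)
  qed
  define index where "index w v e = (\<Sum>e'<e. of_bool (T w v e') :: nat)" for w v e
  have index_card: "index w v e = card {e'. T w v e' \<and> e' < e}" for w v e
    by (simp add: index_def Int_def conj_commute of_bool_def sum.If_cases)
  have decT: "tc w \<Longrightarrow> tc v \<Longrightarrow> tc e \<Longrightarrow> dec (\<lambda>x. T (w x) (v x) (e x))" for w v e
  proof -
    have "dec (\<lambda>z. T (pfst z) (pfst (psnd z)) (psnd (psnd z)))"
      unfolding T_def by (intro tc_intros dec_comp2[OF R])
    then show "tc w \<Longrightarrow> tc v \<Longrightarrow> tc e \<Longrightarrow> dec (\<lambda>x. T (w x) (v x) (e x))"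
      using dec_comp[of "\<lambda>z. T (pfst z) (pfst (psnd z)) (psnd (psnd z))"
          "\<lambda>x. pair (w x) (pair (v x) (e x))"] by (simp add: tc_pair)
  qed
  define G where "G p v u \<longleftrightarrow>
    (\<exists>w e. p = spair w (index w v e) \<and> T w v e \<and> u = pfst e)" for p v u
  have reG: "re (\<lambda>z. G (pfst z) (pfst (psnd z)) (psnd (psnd z)))"
    unfolding G_def index_def
    by (intro re_ex re_dec tc_intros decT tc_spair)
  have G_functional: "u = u'" if G: "G p v u" "G p v u'" for p v u u'
  proof -
    obtain w e where e: "p = spair w (index w v e)" "T w v e" "u = pfst e"
      using G(1) G_def by blast
    obtain w' e' where e': "p = spair w' (index w' v e')" "T w' v e'" "u' = pfst e'"
      using G(2) G_def by blast
    have w: "w' = w" and index: "index w v e = index w v e'" using e(1) e'(1) by auto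
    \<comment> \<open>The index grows strictly past each canonical code, so equal indices force
      equal codes.\<close>
    have "index w v d < index w v d'" if "d < d'" "T w v d" for d d'
      unfolding index_card using that by (intro psubset_card_mono) auto
    then have "e = e'" using index e(2) e'(2) unfolding w by (metis less_irrefl linorder_neqE_nat)
    then show ?thesis using e(3) e'(3) by simp
  qed
  have "\<exists>c. \<forall>p v u. G p v u \<longrightarrow> K u v \<le> len p + c"
    by (rule K_bound[OF reG]) (rule G_functional)
  then obtain c where c: "\<And>p v u. G p v u \<Longrightarrow> K u v \<le> len p + c" by blast
  \<comment> \<open>\<open>spair\<close> doubles the digits of \<open>w\<close> and adds a separator
    of two digits.\<close>
  have "K u v \<le> n + 2 * len w + (c + 2)"
    if Q: "Q w v u" and fin: "finite {u. Q w v u}" and card: "card {u. Q w v u} \<le> 2 ^ n" for w v u n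
  proof -
    obtain e where e: "T w v e" "pfst e = u" using Q QT by blast
    have "index w v e < card {e'. T w v e' \<and> e' < Suc e}"
      unfolding index_card using e by (intro psubset_card_mono) auto
    also have "\<dots> \<le> card {u. Q w v u}"
    proof (rule card_inj_on_le[OF _ _ fin])
      show "inj_on pfst {e'. T w v e' \<and> e' < Suc e}"
        by (rule inj_on_subset[OF T_inj]) auto
      show "pfst ` {e'. T w v e' \<and> e' < Suc e} \<subseteq> {u. Q w v u}" using QT by blast
    qed
    \<comment> \<open>An index below \<open>2 ^ n\<close> is coded by a string of length at most
      \<open>n\<close>, because codes of that length reach up to
      \<open>2 ^ (n + 1) - 2\<close>.\<close>
    finally have "index w v e + 1 < 2 ^ (n + 1)" using card by simp
    then have "len (index w v e) \<le> n" by (simp only: len_le_iff)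
    moreover have "K u v \<le> len (spair w (index w v e)) + c"
      using e by (intro c) (auto simp: G_def)
    ultimately show ?thesis by (simp add: len_spair)
  qed
  then show ?thesis by blast
qed

end

section \<open>Shifts that trap few strings\<close>

text \<open>Here \<open>i\<close> is the position of a program among the strings of its length and
  \<open>\<rho>\<close> lists the shifts belonging to one \<open>a\<close>. With \<open>T\<close>
  the set of useless strings, no shift helps a program at a position that witnesses the
  trap.\<close>

definition trapped :: "nat \<Rightarrow> nat \<Rightarrow> (nat \<Rightarrow> nat) \<Rightarrow> nat set \<Rightarrow> bool" where
  "trapped B d \<rho> T \<longleftrightarrow> (\<exists>i<B. \<forall>j<d. (i + \<rho> j) mod B \<in> T)"

lemma mod_add_left_inj:
  fixes i x y B :: nat
  assumes "x < B" "y < B" "(i + x) mod B = (i + y) mod B"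
  shows "x = y"
proof -
  have *: "x = y" if "x < B" "y < B" "(i + x) mod B = (i + y) mod B" "x \<le> y" for x y
  proof -
    have "B dvd (i + y) - (i + x)" using mod_eq_dvd_iff_nat[of "i + x" "i + y" B] that by simp
    then have "B dvd y - x" by simp
    then show ?thesis using that by (auto dest: dvd_imp_le)
  qed
  then show ?thesis using *[OF assms] *[OF assms(2,1) assms(3)[symmetric]] by (metis nle_le)
qed

lemma card_translate_le:
  fixes i B :: nat
  assumes "finite T"
  shows "card {x \<in> {..<B}. (i + x) mod B \<in> T} \<le> card T"
proof (rule card_inj_on_le[OF _ _ assms])
  show "inj_on (\<lambda>x. (i + x) mod B) {x \<in> {..<B}. (i + x) mod B \<in> T}"
    by (rule inj_onI, rule mod_add_left_inj[of _ B _ i]) simp_all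
qed auto

text \<open>Union bound over \<open>i\<close>: for fixed \<open>i\<close>, each of the
  \<open>d\<close> coordinates has at most \<open>card T\<close> admissible values, since
  translation modulo \<open>B\<close> is injective.\<close>

lemma card_trapped_le:
  assumes "finite T"
  shows "card {\<rho> \<in> {..<d} \<rightarrow>\<^sub>E {..<B}. trapped B d \<rho> T} \<le> B * card T ^ d"
proof -
  let ?P = "\<lambda>i. {..<d} \<rightarrow>\<^sub>E {x \<in> {..<B}. (i + x) mod B \<in> T}"
  have "{\<rho> \<in> {..<d} \<rightarrow>\<^sub>E {..<B}. trapped B d \<rho> T} \<subseteq> (\<Union>i<B. ?P i)"
    by (fastforce simp: trapped_def PiE_iff)
  moreover have "finite (\<Union>i<B. ?P i)" by (intro finite_UN_I finite_PiE) auto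
  ultimately have "card {\<rho> \<in> {..<d} \<rightarrow>\<^sub>E {..<B}. trapped B d \<rho> T} \<le> card (\<Union>i<B. ?P i)"
    by (rule card_mono[rotated])
  also have "\<dots> \<le> (\<Sum>i<B. card (?P i))" by (rule card_UN_le) simp
  also have "\<dots> \<le> (\<Sum>i<B. card T ^ d)"
    by (intro sum_mono) (simp only: card_funcsetE finite_lessThan card_lessThan,
        intro power_mono card_translate_le assms, simp)
  finally show ?thesis by simp
qed

text \<open>\<open>q\<close> bounds the probability that uniformly random shifts trap a given
  \<open>T\<close>. The expected weighted sum is at most the right-hand side, so some choice does no
  worse.\<close>

lemma trapped_averaging:
  fixes w :: "nat set \<Rightarrow> real" and X q :: real
  assumes "B > 0" "X \<ge> 0" and fin: "finite \<T>" and w: "\<And>T. T \<in> \<T> \<Longrightarrow> w T \<ge> 0"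
    and few: "\<And>T. T \<in> \<T> \<Longrightarrow>
      real (card {\<rho> \<in> {..<d} \<rightarrow>\<^sub>E {..<B}. trapped B d \<rho> T}) \<le> q * real (card ({..<d} \<rightarrow>\<^sub>E {..<B}))"
  shows "\<exists>\<rho>. (\<Sum>T\<in>\<T>. w T * (1 + X * of_bool (trapped B d \<rho> T))) \<le> (1 + X * q) * (\<Sum>T\<in>\<T>. w T)"
proof (rule ccontr)
  let ?R = "{..<d} \<rightarrow>\<^sub>E {..<B}"
  have finR: "finite ?R" by (intro finite_PiE) auto
  have "?R \<noteq> {}" using assms(1) by (simp add: PiE_eq_empty_iff lessThan_empty_iff)
  assume "\<not> ?thesis"
  then have large: "(\<Sum>T\<in>\<T>. w T * (1 + X * of_bool (trapped B d \<rho> T))) > (1 + X * q) * (\<Sum>T\<in>\<T>. w T)" for \<rho>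
    by (simp add: not_le)
  have "real (card ?R) * ((1 + X * q) * (\<Sum>T\<in>\<T>. w T)) =
      (\<Sum>\<rho>\<in>?R. (1 + X * q) * (\<Sum>T\<in>\<T>. w T))" by simp
  also have "\<dots> < (\<Sum>\<rho>\<in>?R. \<Sum>T\<in>\<T>. w T * (1 + X * of_bool (trapped B d \<rho> T)))"
    using finR \<open>?R \<noteq> {}\<close> large by (intro sum_strict_mono) auto
  also have "\<dots> = (\<Sum>T\<in>\<T>. \<Sum>\<rho>\<in>?R. w T * (1 + X * of_bool (trapped B d \<rho> T)))"
    by (rule sum.swap)
  also have "\<dots> = (\<Sum>T\<in>\<T>. w T * (real (card ?R) + X * real (card {\<rho> \<in> ?R. trapped B d \<rho> T})))"
  proof (intro sum.cong refl)
    fix T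
    have "(\<Sum>\<rho>\<in>?R. of_bool (trapped B d \<rho> T)) = real (card {\<rho> \<in> ?R. trapped B d \<rho> T})"
      using finR by (simp add: Int_def sum_of_bool_eq)
    then show "(\<Sum>\<rho>\<in>?R. w T * (1 + X * of_bool (trapped B d \<rho> T))) =
        w T * (real (card ?R) + X * real (card {\<rho> \<in> ?R. trapped B d \<rho> T}))"
      by (simp only: sum_distrib_left[symmetric] sum.distrib sum_constant) simp
  qed
  also have "\<dots> \<le> (\<Sum>T\<in>\<T>. w T * (real (card ?R) + X * (q * real (card ?R))))"
    using few w assms(2) by (intro sum_mono mult_left_mono add_left_mono) auto
  also have "\<dots> = (\<Sum>T\<in>\<T>. real (card ?R) * (1 + X * q) * w T)"
    by (simp add: algebra_simps)
  also have "\<dots> = real (card ?R) * ((1 + X * q) * (\<Sum>T\<in>\<T>. w T))"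
    by (simp only: sum_distrib_left mult.assoc)
  finally show False by simp
qed

text \<open>Greedy choice, one \<open>a\<close> at a time: the current potentials serve as the
  weights in \<open>trapped_averaging\<close>, and each round costs a factor of at most
  \<open>1 + X * q\<close>.\<close>

lemma trapped_potential:
  fixes w :: "nat set \<Rightarrow> real" and X q :: real
  assumes "B > 0" "X \<ge> 0" "q \<ge> 0" "finite \<T>" "\<And>T. T \<in> \<T> \<Longrightarrow> w T \<ge> 0"
    and "\<And>T. T \<in> \<T> \<Longrightarrow>
      real (card {\<rho> \<in> {..<d} \<rightarrow>\<^sub>E {..<B}. trapped B d \<rho> T}) \<le> q * real (card ({..<d} \<rightarrow>\<^sub>E {..<B}))"
  shows "\<exists>\<rho>. (\<Sum>T\<in>\<T>. w T * (1 + X) ^ card {a. a < n \<and> trapped B d (\<rho> a) T})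
    \<le> (1 + X * q) ^ n * (\<Sum>T\<in>\<T>. w T)"
proof (induction n)
  case 0
  show ?case by simp
next
  case (Suc n)
  then obtain \<rho> where IH: "(\<Sum>T\<in>\<T>. w T * (1 + X) ^ card {a. a < n \<and> trapped B d (\<rho> a) T})
    \<le> (1 + X * q) ^ n * (\<Sum>T\<in>\<T>. w T)" by blast
  let ?v = "\<lambda>T. w T * (1 + X) ^ card {a. a < n \<and> trapped B d (\<rho> a) T}"
  have "\<exists>r. (\<Sum>T\<in>\<T>. ?v T * (1 + X * of_bool (trapped B d r T))) \<le> (1 + X * q) * (\<Sum>T\<in>\<T>. ?v T)"
    using assms by (intro trapped_averaging) auto
  then obtain r where r: "(\<Sum>T\<in>\<T>. ?v T * (1 + X * of_bool (trapped B d r T)))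
    \<le> (1 + X * q) * (\<Sum>T\<in>\<T>. ?v T)" by blast
  have split: "{a. a < Suc n \<and> trapped B d ((\<rho>(n := r)) a) T} =
      {a. a < n \<and> trapped B d (\<rho> a) T} \<union> (if trapped B d r T then {n} else {})" for T
    by (auto simp: less_Suc_eq)
  have "(1 + X) ^ card {a. a < Suc n \<and> trapped B d ((\<rho>(n := r)) a) T} =
      (1 + X) ^ card {a. a < n \<and> trapped B d (\<rho> a) T} * (1 + X * of_bool (trapped B d r T))" for T
    unfolding split by simp
  then have "(\<Sum>T\<in>\<T>. w T * (1 + X) ^ card {a. a < Suc n \<and> trapped B d ((\<rho>(n := r)) a) T})
      = (\<Sum>T\<in>\<T>. ?v T * (1 + X * of_bool (trapped B d r T)))"
    by (simp add: mult.assoc)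
  also have "\<dots> \<le> (1 + X * q) * ((1 + X * q) ^ n * (\<Sum>T\<in>\<T>. w T))"
    using r mult_left_mono[OF IH, of "1 + X * q"] assms(2,3) by simp
  finally show ?case by (auto simp: mult.assoc)
qed

lemma sum_power_card_subsets:
  fixes y :: real
  assumes "finite A"
  shows "(\<Sum>T\<in>Pow A. y ^ card T) = (1 + y) ^ card A"
  using prod_add[OF assms, of "\<lambda>_. y" "\<lambda>_. 1"] by (simp add: add.commute)

text \<open>Random shifts are modelled by a potential: each set \<open>T\<close> has weight \<open>B ^ (- card T)\<close>, multiplied
  by \<open>16 * B\<close> for every trapped \<open>a\<close>. The shifts are chosen one \<open>a\<close> at a time so that the potential
  stays below \<open>exp 2 < 16\<close>, whereas \<open>card T + 1\<close> trapped \<open>a\<close> would push it to 16.\<close>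

lemma few_trapped_exists:
  fixes B d U :: nat
  assumes "B > 0" and size: "16 * U * B * B \<le> 2 ^ d"
  shows "\<exists>\<rho>. \<forall>T. T \<subseteq> {..<B} \<and> 2 * card T \<le> B \<longrightarrow> card {a. a < U \<and> trapped B d (\<rho> a) T} \<le> card T"
proof -
  define \<T> where "\<T> = {T. T \<subseteq> {..<B} \<and> 2 * card T \<le> B}"
  define w where "w T = (1 / real B) ^ card T" for T :: "nat set"
  \<comment> \<open>For \<open>card T \<le> B / 2\<close> the bound \<open>B * card T ^ d\<close>,
    divided by the number \<open>B ^ d\<close> of shift vectors, is at most this.\<close>
  define q where "q = real B / 2 ^ d"
  define X where "X = 16 * real B - 1"
  have B: "real B \<ge> 1" using assms(1) by simp
  have X: "X \<ge> 0" "1 + X = 16 * real B" using B by (simp_all add: X_def)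
  have q: "q \<ge> 0" by (simp add: q_def)
  have \<T>: "\<T> \<subseteq> Pow {..<B}" by (auto simp: \<T>_def)
  then have fin: "finite \<T>" by (rule finite_subset) simp
  have few: "real (card {\<rho> \<in> {..<d} \<rightarrow>\<^sub>E {..<B}. trapped B d \<rho> T}) \<le> q * real (card ({..<d} \<rightarrow>\<^sub>E {..<B}))"
    if "T \<in> \<T>" for T
  proof -
    have T: "finite T" "real (card T) \<le> real B / 2"
      using that finite_subset[of T "{..<B}"] by (auto simp: \<T>_def)
    have "real (card {\<rho> \<in> {..<d} \<rightarrow>\<^sub>E {..<B}. trapped B d \<rho> T}) \<le> real B * real (card T) ^ d"
      using card_trapped_le[OF T(1), of d B] by (metis of_nat_le_iff of_nat_mult of_nat_power)
    also have "\<dots> \<le> real B * (real B / 2) ^ d"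
      using T(2) by (intro mult_left_mono power_mono) auto
    also have "\<dots> = q * real (card ({..<d} \<rightarrow>\<^sub>E {..<B}))"
      by (simp add: card_funcsetE q_def power_divide)
    finally show ?thesis .
  qed
  have "\<exists>\<rho>. (\<Sum>T\<in>\<T>. w T * (1 + X) ^ card {a. a < U \<and> trapped B d (\<rho> a) T})
    \<le> (1 + X * q) ^ U * (\<Sum>T\<in>\<T>. w T)"
    using assms(1) X(1) q fin few by (intro trapped_potential) (auto simp: w_def)
  then obtain \<rho> where \<rho>: "(\<Sum>T\<in>\<T>. w T * (1 + X) ^ card {a. a < U \<and> trapped B d (\<rho> a) T})
    \<le> (1 + X * q) ^ U * (\<Sum>T\<in>\<T>. w T)" by blast
  \<comment> \<open>Over all subsets of \<open>{..<B}\<close> the weights sum to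
    \<open>(1 + 1 / B) ^ B\<close> by the binomial theorem.\<close>
  have "(\<Sum>T\<in>\<T>. w T) \<le> (\<Sum>T\<in>Pow {..<B}. w T)"
    using \<T> by (intro sum_mono2) (auto simp: w_def)
  also have "\<dots> = (1 + 1 / real B) ^ B"
    unfolding w_def using sum_power_card_subsets[of "{..<B}" "1 / real B"] by simp
  also have "\<dots> \<le> exp (1 / real B) ^ B" by (intro power_mono exp_ge_add_one_self) simp
  also have "\<dots> = exp 1" using assms(1) by (simp flip: exp_of_nat_mult)
  finally have w_sum: "(\<Sum>T\<in>\<T>. w T) \<le> exp 1" .
  have "real U * (X * q) \<le> real U * (16 * real B * q)"
    using q by (intro mult_left_mono mult_right_mono) (auto simp: X_def)
  also have "\<dots> = real (16 * U * B * B) / 2 ^ d" by (simp add: q_def)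
  also have "\<dots> \<le> 1" using size by (simp add: divide_le_eq_1 of_nat_le_iff flip: of_nat_le_iff[where 'a=real])
  finally have UXq: "real U * (X * q) \<le> 1" .
  have "(1 + X * q) ^ U \<le> exp (X * q) ^ U"
    using X(1) q by (intro power_mono exp_ge_add_one_self) simp
  also have "\<dots> = exp (real U * (X * q))" by (simp add: exp_of_nat_mult)
  also have "\<dots> \<le> exp 1" using UXq by simp
  finally have "(1 + X * q) ^ U * (\<Sum>T\<in>\<T>. w T) \<le> exp 1 * exp 1"
    using w_sum X(1) q by (intro mult_mono) (auto intro: sum_nonneg simp: w_def)
  also have "\<dots> \<le> 3 * 3" by (intro mult_mono exp_le) auto
  finally have small: "(1 + X * q) ^ U * (\<Sum>T\<in>\<T>. w T) < 16" by simp
  have "card {a. a < U \<and> trapped B d (\<rho> a) T} \<le> card T" if T: "T \<in> \<T>" for T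
  proof (rule ccontr)
    assume "\<not> ?thesis"
    then have "(16 * real B) ^ Suc (card T) \<le> (1 + X) ^ card {a. a < U \<and> trapped B d (\<rho> a) T}"
      unfolding X(2) using B by (intro power_increasing) auto
    then have "w T * (16 * real B) ^ Suc (card T) \<le>
        w T * (1 + X) ^ card {a. a < U \<and> trapped B d (\<rho> a) T}"
      by (intro mult_left_mono) (auto simp: w_def)
    also have "\<dots> \<le> (\<Sum>T\<in>\<T>. w T * (1 + X) ^ card {a. a < U \<and> trapped B d (\<rho> a) T})"
      using fin T X(1) by (intro member_le_sum) (auto simp: w_def)
    also have "\<dots> < 16" using \<rho> small by linarith
    finally have "w T * (16 * real B) ^ Suc (card T) < 16" .
    \<comment> \<open>The weight \<open>B ^ (- card T)\<close> cancels all but one of the factors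
      \<open>B\<close>.\<close>
    moreover have "w T * (16 * real B) ^ Suc (card T) = 16 ^ card T * (16 * real B)"
      using B by (simp add: w_def power_mult_distrib power_one_over)
    moreover have "16 * 1 \<le> 16 ^ card T * (16 * real B)"
      using mult_mono[of 1 "16 ^ card T :: real" 16 "16 * real B"] B by simp
    ultimately show False by linarith
  qed
  then show ?thesis unfolding \<T>_def by blast
qed

section \<open>A computable choice of shifts\<close>

definition shift_count :: "nat \<Rightarrow> nat \<Rightarrow> nat" where
  "shift_count N k = N + 2 * k + 5"

text \<open>Written with bounded quantifiers and sums only, so that it is decidable: the binary
  digits of \<open>T\<close> are the characteristic function of a set, and \<open>R\<close> codes a
  table of shifts indexed by \<open>pair a j\<close>.\<close>

definition good_shifts :: "nat \<Rightarrow> nat \<Rightarrow> nat \<Rightarrow> bool" where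
  "good_shifts N k R \<longleftrightarrow> (\<forall>T<2 ^ 2 ^ k.
    2 * (\<Sum>f<2 ^ k. of_bool ((T :: nat) div 2 ^ f mod 2 = 1)) \<le> (2 ^ k :: nat) \<longrightarrow>
    (\<Sum>a<2 ^ (N + 1). of_bool (\<exists>i<2 ^ k. \<forall>j<shift_count N k.
      T div 2 ^ ((i + nth_code R (pair a j)) mod 2 ^ k) mod 2 = 1)) \<le>
    (\<Sum>f<2 ^ k. of_bool (T div 2 ^ f mod 2 = 1) :: nat))"

lemma good_shifts_iff:
  "good_shifts N k R \<longleftrightarrow> (\<forall>T. T \<subseteq> {..<2 ^ k} \<and> 2 * card T \<le> 2 ^ k \<longrightarrow>
    card {a. a < 2 ^ (N + 1) \<and> trapped (2 ^ k) (shift_count N k) (\<lambda>j. nth_code R (pair a j)) T} \<le> card T)"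
proof -
  have digit: "T div 2 ^ f mod 2 = 1 \<longleftrightarrow> f \<in> set_decode T" for T f :: nat
    by (simp add: set_decode_def odd_iff_mod_2_eq_one)
  have count: "(\<Sum>x<n. of_bool (P x)) = card {x. x < n \<and> P x}" for n :: nat and P
    by (simp add: Int_def lessThan_def sum_of_bool_eq)
  have sub: "set_decode T \<subseteq> {..<n}" if "T < 2 ^ n" for T n :: nat
  proof
    fix f assume "f \<in> set_decode T"
    then have "T div 2 ^ f \<noteq> 0" by (auto simp: set_decode_def intro: ccontr)
    then have "2 ^ f \<le> T" by (simp add: div_eq_0_iff not_less)
    then have "(2::nat) ^ f < 2 ^ n" using that by linarith
    then show "f \<in> {..<n}" by simp
  qed
  have bound: "set_encode T < 2 ^ n" if "T \<subseteq> {..<n}" for T and n :: nat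
  proof -
    have "set_encode T \<le> (\<Sum>f<n. 2 ^ f)"
      unfolding set_encode_def using that by (intro sum_mono2) auto
    also have "\<dots> < 2 ^ n" by (induction n) auto
    finally show ?thesis .
  qed
  \<comment> \<open>By \<open>set_encode\<close>, the numbers below \<open>2 ^ n\<close> run through
    all subsets of \<open>{..<n}\<close>.\<close>
  have sets: "(\<forall>T<2 ^ n. P (set_decode T)) \<longleftrightarrow> (\<forall>T\<subseteq>{..<n}. P T)" for n :: nat and P
  proof
    assume *: "\<forall>T<2 ^ n. P (set_decode T)"
    show "\<forall>T\<subseteq>{..<n}. P T"
    proof (intro allI impI)
      fix T assume "T \<subseteq> {..<n}"
      then show "P T" using * bound[of T n] finite_subset[of T "{..<n}"] by force
    qed
  qed (use sub in blast)
  have "{f. f < 2 ^ k \<and> f \<in> T} = T" if "T \<subseteq> {..<2 ^ k}" for T :: "nat set"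
    using that by auto
  then show ?thesis
    unfolding good_shifts_def digit count sets[of "2 ^ k" "\<lambda>T. 2 * card {f. f < 2 ^ k \<and> f \<in> T} \<le> 2 ^ k \<longrightarrow>
      card {a. a < 2 ^ (N + 1) \<and> (\<exists>i<2 ^ k. \<forall>j<shift_count N k. (i + nth_code R (pair a j)) mod 2 ^ k \<in> T)}
      \<le> card {f. f < 2 ^ k \<and> f \<in> T}"] trapped_def
    by (simp add: imp_conjL)
qed

lemma good_shifts_exist: "\<exists>R. good_shifts N k R"
proof -
  define B U d :: nat where "B = 2 ^ k" and "U = 2 ^ (N + 1)" and "d = shift_count N k"
  \<comment> \<open>The value of \<open>shift_count\<close> is chosen for this equation: 4 for the
    factor 16, \<open>N + 1\<close> for \<open>U\<close>, and \<open>k\<close> for each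
    \<open>B\<close>.\<close>
  have "16 * U * B * B = 2 ^ d"
    unfolding B_def U_def d_def shift_count_def
    by (simp only: power_add mult_2) simp
  then have "\<exists>\<rho>. \<forall>T. T \<subseteq> {..<B} \<and> 2 * card T \<le> B \<longrightarrow> card {a. a < U \<and> trapped B d (\<rho> a) T} \<le> card T"
    by (intro few_trapped_exists) (simp_all add: B_def)
  then obtain \<rho> where \<rho>: "\<And>T. T \<subseteq> {..<B} \<Longrightarrow> 2 * card T \<le> B \<Longrightarrow>
      card {a. a < U \<and> trapped B d (\<rho> a) T} \<le> card T" by blast
  obtain R where R: "\<forall>x<(U + d + 1) ^ 2. nth_code R x = \<rho> (pfst x) (psnd x)"
    using nth_code_exists[of "(U + d + 1) ^ 2" "\<lambda>x. \<rho> (pfst x) (psnd x)"] by blast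
  have "nth_code R (pair a j) = \<rho> a j" if "a < U" "j < d" for a j
  proof -
    have "pair a j < (a + j + 1) ^ 2" by (rule pair_less)
    also have "\<dots> \<le> (U + d + 1) ^ 2" using that by (intro power_mono) auto
    finally show ?thesis using R by simp
  qed
  then have "{a. a < U \<and> trapped B d (\<lambda>j. nth_code R (pair a j)) T} =
      {a. a < U \<and> trapped B d (\<rho> a) T}" for T
    by (auto simp: trapped_def)
  then have "good_shifts N k R" unfolding good_shifts_iff using \<rho> by (simp add: B_def U_def d_def)
  then show ?thesis by blast
qed

text \<open>Taking the least good table makes the shifts computable from \<open>N\<close>,
  \<open>k\<close>, \<open>a\<close> and \<open>j\<close>, so a decoder can find them again.\<close>

definition shift :: "nat \<Rightarrow> nat \<Rightarrow> nat \<Rightarrow> nat \<Rightarrow> nat" where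
  "shift N k a j = nth_code (LEAST R. good_shifts N k R) (pair a j)"

lemma card_trapped_shift:
  assumes "T \<subseteq> {..<2 ^ k}" "2 * card T \<le> 2 ^ k"
  shows "card {a. a < 2 ^ (N + 1) \<and> trapped (2 ^ k) (shift_count N k) (shift N k a) T} \<le> card T"
proof -
  have "good_shifts N k (LEAST R. good_shifts N k R)" using good_shifts_exist by (rule LeastI_ex)
  then show ?thesis using assms unfolding good_shifts_iff shift_def by simp
qed

lemma tc_shift_count: "tc f \<Longrightarrow> tc g \<Longrightarrow> tc (\<lambda>x. shift_count (f x) (g x))"
  unfolding shift_count_def by (intro tc_intros)

lemma tc_shift:
  assumes "tc f" "tc g" "tc h" "tc e"
  shows "tc (\<lambda>x. shift (f x) (g x) (h x) (e x))"
proof -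
  have "tc (\<lambda>z. LEAST R. good_shifts (pfst z) (psnd z) R)"
  proof (rule tc_Least[OF _ good_shifts_exist])
    show "dec (\<lambda>z. good_shifts (pfst (pfst z)) (psnd (pfst z)) (psnd z))"
      unfolding good_shifts_def by (intro tc_intros tc_nth_code tc_shift_count)
  qed
  then have "tc (\<lambda>x. LEAST R. good_shifts (f x) (g x) R)"
    by (rule tc_lift2[of "\<lambda>N k. LEAST R. good_shifts N k R", OF _ assms(1,2)])
  then show ?thesis unfolding shift_def by (intro tc_nth_code tc_pair assms)
qed

section \<open>Symmetry of information and fingerprints\<close>

text \<open>For an enumerable predicate a lower bound on the number of solutions is again
  enumerable, whereas an exact count need not be.\<close>

definition at_least :: "nat \<Rightarrow> ('a \<Rightarrow> bool) \<Rightarrow> bool" where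
  "at_least q P \<longleftrightarrow> (\<exists>S. finite S \<and> card S = q \<and> S \<subseteq> Collect P)"

lemma at_least_card: "finite {y. P y} \<Longrightarrow> q \<le> card {y. P y} \<Longrightarrow> at_least q P"
  unfolding at_least_def by (metis obtain_subset_with_card_n)

lemma at_least_code_iff:
  fixes P :: "nat \<Rightarrow> bool"
  shows "at_least q P \<longleftrightarrow>
    (\<exists>c. \<forall>i<q. P (nth_code c i) \<and> (\<forall>j<i. nth_code c j \<noteq> nth_code c i))"
proof
  assume "at_least q P"
  then obtain S where S: "finite S" "card S = q" "S \<subseteq> Collect P" unfolding at_least_def by blast
  obtain f where f: "bij_betw f {..<q} S"
    using ex_bij_betw_nat_finite[OF S(1)] S(2) by (auto simp: atLeast0LessThan)
  obtain c where c: "\<forall>i<q. nth_code c i = f i" using nth_code_exists[of q f] by blast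
  have "P (f i)" if "i < q" for i using f S(3) that by (auto simp: bij_betw_def)
  moreover have "f j \<noteq> f i" if "i < q" "j < i" for i j
    using f that by (auto simp: bij_betw_def inj_on_def)
  ultimately show "\<exists>c. \<forall>i<q. P (nth_code c i) \<and> (\<forall>j<i. nth_code c j \<noteq> nth_code c i)"
    using c by (intro exI[of _ c]) (metis less_trans)
next
  assume "\<exists>c. \<forall>i<q. P (nth_code c i) \<and> (\<forall>j<i. nth_code c j \<noteq> nth_code c i)"
  then obtain c where c: "\<And>i. i < q \<Longrightarrow> P (nth_code c i)"
    "\<And>i j. i < q \<Longrightarrow> j < i \<Longrightarrow> nth_code c j \<noteq> nth_code c i" by blast
  have "inj_on (nth_code c) {..<q}"
    by (rule linorder_inj_onI) (use c(2) in auto)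
  then have "card (nth_code c ` {..<q}) = q" by (simp add: card_image)
  then show "at_least q P"
    unfolding at_least_def using c(1) by (intro exI[of _ "nth_code c ` {..<q}"]) auto
qed

lemma re_at_least:
  assumes "tc g" "re (\<lambda>z. P (pfst z) (psnd z))"
  shows "re (\<lambda>x. at_least (g x) (P x))"
  unfolding at_least_code_iff
  by (intro re_ex re_ball re_conj re_dec dec_not dec_eq re_comp2[OF assms(2)] tc_nth_code
      tc_comp[OF assms(1) tc_pfst[OF tc_id]] tc_pfst tc_psnd tc_id)

text \<open>Double counting: every such \<open>x\<close> contributes \<open>q\<close> pairs to
  \<open>X\<close>.\<close>

lemma card_at_least:
  assumes "finite X" "q > 0"
  shows "finite {x. at_least q (\<lambda>y. (x, y) \<in> X)}"
    and "card {x. at_least q (\<lambda>y. (x, y) \<in> X)} * q \<le> card X"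
proof -
  let ?A = "{x. at_least q (\<lambda>y. (x, y) \<in> X)}"
  have "\<forall>x\<in>?A. \<exists>S. finite S \<and> card S = q \<and> S \<subseteq> {y. (x, y) \<in> X}"
    by (simp add: at_least_def)
  then obtain S where S: "\<And>x. x \<in> ?A \<Longrightarrow> finite (S x) \<and> card (S x) = q \<and> S x \<subseteq> {y. (x, y) \<in> X}"
    by metis
  have "?A \<subseteq> fst ` X"
  proof
    fix x assume "x \<in> ?A"
    then have "S x \<noteq> {}" "S x \<subseteq> {y. (x, y) \<in> X}" using S[of x] assms(2) by auto
    then show "x \<in> fst ` X" by force
  qed
  then show fin: "finite ?A" using assms(1) by (meson finite_imageI finite_subset)
  have "card (Sigma ?A S) = (\<Sum>x\<in>?A. card (S x))" using fin S by (intro card_SigmaI) auto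
  also have "\<dots> = card ?A * q" using S by simp
  finally have "card ?A * q = card (Sigma ?A S)" by simp
  also have "\<dots> \<le> card X" using S assms(1) by (intro card_mono) auto
  finally show "card ?A * q \<le> card X" .
qed

text \<open>The existence of one such \<open>x\<close> gives \<open>h \<le> e\<close>, so that the
  truncated difference \<open>e - h\<close> is a true one.\<close>

lemma card_at_least_power:
  assumes "finite X" "card X \<le> 2 ^ e" "at_least (2 ^ h) (\<lambda>y. (x, y) \<in> X)"
  shows "finite {x. at_least (2 ^ h) (\<lambda>y. (x, y) \<in> X)}"
    and "h \<le> e"
    and "card {x. at_least (2 ^ h) (\<lambda>y. (x, y) \<in> X)} \<le> 2 ^ (e - h)"
proof -
  let ?A = "{x. at_least (2 ^ h) (\<lambda>y. (x, y) \<in> X)}"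
  show fin: "finite ?A" using card_at_least(1)[OF assms(1), of "2 ^ h"] by simp
  have bound: "card ?A * 2 ^ h \<le> 2 ^ e"
    using card_at_least(2)[OF assms(1), of "2 ^ h"] assms(2) by simp
  have "card ?A \<ge> 1" using fin assms(3) by (auto simp: Suc_le_eq card_gt_0_iff)
  then have "(2::nat) ^ h \<le> 2 ^ e" using bound mult_le_mono1[of 1 "card ?A" "2 ^ h"] by linarith
  then show "h \<le> e" by simp
  then have "(2::nat) ^ e = 2 ^ (e - h) * 2 ^ h" by (simp flip: power_add)
  then show "card ?A \<le> 2 ^ (e - h)" using bound by simp
qed

text \<open>Functionality makes any choice of witnesses injective. Serves to count objects by their
  programs.\<close>

lemma card_le_of_witness:
  assumes "finite B" "\<And>x. x \<in> A \<Longrightarrow> \<exists>p\<in>B. R p x"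
    and functional: "\<And>p x x'. R p x \<Longrightarrow> R p x' \<Longrightarrow> x = x'"
  shows "finite A" and "card A \<le> card B"
proof -
  obtain f where f: "\<And>x. x \<in> A \<Longrightarrow> f x \<in> B \<and> R (f x) x" using assms(2) by metis
  have inj: "inj_on f A"
  proof (rule inj_onI)
    fix x y assume "x \<in> A" "y \<in> A" "f x = f y"
    then show "x = y" using f[of x] f[of y] functional[of "f x" x y] by simp
  qed
  have sub: "f ` A \<subseteq> B" using f by blast
  show "finite A" using inj_on_finite[OF inj sub assms(1)] .
  show "card A \<le> card B" using card_inj_on_le[OF inj sub assms(1)] .
qed

text \<open>Strings of length \<open>k\<close> are the numbers from \<open>2 ^ k - 1\<close> to
  \<open>2 ^ (k + 1) - 2\<close>. The position \<open>p + 1 - 2 ^ k\<close> of \<open>p\<close> in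
  this block is translated modulo \<open>2 ^ k\<close> and put back into the block.\<close>

definition fingerprint :: "nat \<Rightarrow> nat \<Rightarrow> nat \<Rightarrow> nat \<Rightarrow> nat \<Rightarrow> nat" where
  "fingerprint N k a j p = 2 ^ k - 1 + (p + 1 - 2 ^ k + shift N k a j) mod 2 ^ k"

lemma len_fingerprint [simp]: "len (fingerprint N k a j p) = k"
proof -
  have "(p + 1 - 2 ^ k + shift N k a j) mod 2 ^ k < (2 ^ k :: nat)" by simp
  moreover have "(1::nat) \<le> 2 ^ k" by simp
  ultimately show ?thesis unfolding len_eq_iff fingerprint_def power_add power_one_right by linarith
qed

lemma fingerprint_inj:
  assumes "len p = k" "len p' = k" "fingerprint N k a j p = fingerprint N k a j p'"
  shows "p = p'"
proof -
  have p: "2 ^ k \<le> p + 1" "p + 1 < 2 ^ (k + 1)" "2 ^ k \<le> p' + 1" "p' + 1 < 2 ^ (k + 1)"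
    using assms(1,2) by (simp_all only: len_eq_iff)
  have eq: "(shift N k a j + (p + 1 - 2 ^ k)) mod 2 ^ k = (shift N k a j + (p' + 1 - 2 ^ k)) mod 2 ^ k"
    using assms(3) unfolding fingerprint_def add_left_cancel by (simp only: add.commute)
  have "p + 1 - 2 ^ k < 2 ^ k" "p' + 1 - 2 ^ k < 2 ^ k"
    using p unfolding power_add power_one_right by linarith+
  then have "p + 1 - 2 ^ k = p' + 1 - 2 ^ k" using eq by (rule mod_add_left_inj)
  then show ?thesis using p(1,3) by (metis add_right_cancel le_add_diff_inverse2)
qed

lemma tc_fingerprint:
  "tc N \<Longrightarrow> tc k \<Longrightarrow> tc a \<Longrightarrow> tc j \<Longrightarrow> tc p \<Longrightarrow>
    tc (\<lambda>x. fingerprint (N x) (k x) (a x) (j x) (p x))"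
  unfolding fingerprint_def by (intro tc_intros tc_shift)

text \<open>After passing from strings to positions in the block, every \<open>a\<close> in
  \<open>A\<close> is trapped, with the position of \<open>p\<close> as \<open>i\<close>. The bound
  on \<open>len a\<close> places \<open>a\<close> below \<open>2 ^ (N + 1)\<close>, where the shifts
  were chosen.\<close>

lemma card_all_fingerprints:
  assumes T: "T \<subseteq> {f. len f = k}" and half: "2 * card T \<le> 2 ^ k"
    and A: "\<And>a. a \<in> A \<Longrightarrow> len a \<le> N \<and>
      (\<exists>p. len p = k \<and> (\<forall>j<shift_count N k. fingerprint N k a j p \<in> T))"
  shows "finite A" and "card A \<le> card T"
proof -
  define S where "S = (\<lambda>f. f + 1 - 2 ^ k) ` T"
  have finT: "finite T" using T by (rule finite_subset) simp
  have Tb: "2 ^ k \<le> f + 1 \<and> f + 1 < 2 ^ k + 2 ^ k" if "f \<in> T" for f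
  proof -
    have "len f = k" using T that by blast
    then show ?thesis by (simp add: len_eq_iff)
  qed
  have card_S: "card S \<le> card T" unfolding S_def using finT by (rule card_image_le)
  have "f + 1 - 2 ^ k < 2 ^ k" if "f \<in> T" for f using Tb[OF that] by linarith
  then have sub: "S \<subseteq> {..<2 ^ k}" by (auto simp: S_def)
  have "A \<subseteq> {a. a < 2 ^ (N + 1) \<and> trapped (2 ^ k) (shift_count N k) (shift N k a) S}" (is "_ \<subseteq> ?A'")
  proof
    fix a assume "a \<in> A"
    then obtain p where a: "len a \<le> N" and p: "len p = k"
      and j: "\<And>j. j < shift_count N k \<Longrightarrow> fingerprint N k a j p \<in> T" using A by blast
    have "p + 1 - 2 ^ k < 2 ^ k"
      using p unfolding len_eq_iff power_add power_one_right by linarith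
    moreover have "(p + 1 - 2 ^ k + shift N k a j) mod 2 ^ k \<in> S" if "j < shift_count N k" for j
    proof -
      have "fingerprint N k a j p + 1 - 2 ^ k = (p + 1 - 2 ^ k + shift N k a j) mod 2 ^ k"
        by (simp add: fingerprint_def)
      then show ?thesis unfolding S_def using j[OF that] by (metis imageI)
    qed
    ultimately show "a \<in> ?A'"
      using a unfolding trapped_def len_le_iff by auto
  qed
  moreover have fin: "finite ?A'" by (rule finite_subset[of _ "{..<2 ^ (N + 1)}"]) auto
  ultimately show "finite A" by (rule finite_subset)
  have "card A \<le> card ?A'" using \<open>A \<subseteq> ?A'\<close> fin by (rule card_mono[rotated])
  also have "\<dots> \<le> card S" using card_trapped_shift[OF sub] card_S half by simp
  finally show "card A \<le> card T" using card_S by simp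
qed

section \<open>Counting arguments for complexities\<close>

context optimal_language
begin

text \<open>At most \<open>2 ^ (n + l)\<close> pairs satisfy \<open>X n l\<close>, for
  \<open>n = K b 0\<close> and \<open>l = K a b\<close>. If \<open>a\<close> has about
  \<open>2 ^ t\<close> partners, then \<open>b\<close> is found among them with about
  \<open>t\<close> bits, while \<open>a\<close> is one of at most \<open>2 ^ (n + l - t)\<close>
  strings with that many partners.\<close>

lemma symmetry_of_information:
  "\<exists>c. \<forall>a b. K a 0 + K b a \<le> K b 0 + K a b + c * (len (K b 0 + K a b) + 1)"
proof -
  define X where "X n l a b \<longleftrightarrow> (\<exists>q q'. len q = n \<and> len q' = l \<and> runs q 0 b \<and> runs q' b a)"
    for n l a b
  have reX: "tc n \<Longrightarrow> tc l \<Longrightarrow> tc a \<Longrightarrow> tc b \<Longrightarrow> re (\<lambda>x. X (n x) (l x) (a x) (b x))" for n l a b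
  proof -
    have "re (\<lambda>z. X (pfst z) (pfst (psnd z)) (pfst (psnd (psnd z))) (psnd (psnd (psnd z))))"
      unfolding X_def by (intro re_ex re_conj re_dec re_runs tc_len tc_intros)
    then show "tc n \<Longrightarrow> tc l \<Longrightarrow> tc a \<Longrightarrow> tc b \<Longrightarrow> re (\<lambda>x. X (n x) (l x) (a x) (b x))"
      using re_comp[of "\<lambda>z. X (pfst z) (pfst (psnd z)) (pfst (psnd (psnd z))) (psnd (psnd (psnd z)))"
          "\<lambda>x. pair (n x) (pair (l x) (pair (a x) (b x)))"] by (simp add: tc_pair)
  qed
  have "re (\<lambda>z. X (pfst (pfst z)) (psnd (pfst z)) (pfst (psnd z)) (psnd (psnd z)))"
    by (intro reX tc_intros)
  from K_enumeration[of "\<lambda>w. X (pfst w) (psnd w)", OF this]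
  obtain c1 where c1: "\<And>w v u n. X (pfst w) (psnd w) v u \<Longrightarrow> finite {u. X (pfst w) (psnd w) v u} \<Longrightarrow>
      card {u. X (pfst w) (psnd w) v u} \<le> 2 ^ n \<Longrightarrow> K u v \<le> n + 2 * len w + c1"
    by blast
  have "re (\<lambda>z. at_least (2 ^ pfst (pfst z))
      (X (pfst (psnd (pfst z))) (psnd (psnd (pfst z))) (psnd (psnd z))))"
    by (intro re_at_least reX tc_intros)
  from K_enumeration[of "\<lambda>w v u. at_least (2 ^ pfst w) (X (pfst (psnd w)) (psnd (psnd w)) u)", OF this]
  obtain c2 where c2: "\<And>w v u n. at_least (2 ^ pfst w) (X (pfst (psnd w)) (psnd (psnd w)) u) \<Longrightarrow>
      finite {u. at_least (2 ^ pfst w) (X (pfst (psnd w)) (psnd (psnd w)) u)} \<Longrightarrow>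
      card {u. at_least (2 ^ pfst w) (X (pfst (psnd w)) (psnd (psnd w)) u)} \<le> 2 ^ n \<Longrightarrow>
      K u v \<le> n + 2 * len w + c2"
    by blast
  have "K a 0 + K b a \<le> K b 0 + K a b + (c1 + c2 + 33) * (len (K b 0 + K a b) + 1)" for a b
  proof -
    define n l where "n = K b 0" and "l = K a b"
    define L where "L = len (n + l)"
    define Y where "Y = {(a, b). X n l a b}"
    obtain q q' where q: "len q = n" "runs q 0 b" "len q' = l" "runs q' b a"
      using K_program unfolding n_def l_def by meson
    then have Xab: "X n l a b" unfolding X_def by blast
    define P where "P = {q. len q = n} \<times> {q'. len q' = l}"
    define R where "R qq x \<longleftrightarrow> runs (fst qq) 0 (snd x) \<and> runs (snd qq) (snd x) (fst x)"
      for qq x :: "nat \<times> nat"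
    have "finite P" by (simp add: P_def)
    moreover have "\<exists>qq\<in>P. R qq x" if "x \<in> Y" for x
      using that by (force simp: Y_def X_def P_def R_def)
    moreover have "x = x'" if "R qq x" "R qq x'" for qq x x'
      using that runs_functional unfolding R_def by (metis prod.expand)
    ultimately have Y: "finite Y" "card Y \<le> card P"
      using card_le_of_witness[of P Y R] by blast+
    have cardY: "card Y \<le> 2 ^ (n + l)"
      using Y(2) by (simp add: P_def card_cartesian_product power_add)
    have "{b. X n l a b} \<subseteq> snd ` Y" by (force simp: Y_def)
    then have fin: "finite {b. X n l a b}" using Y(1) by (meson finite_imageI finite_subset)
    then have pos: "card {b. X n l a b} > 0" using Xab by (auto simp: card_gt_0_iff)
    \<comment> \<open>The binary logarithm of the number of partners, rounded down; subtracting 1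
      offsets the \<open>n + 1\<close> in the bounds for \<open>len\<close>.\<close>
    define t where "t = len (card {b. X n l a b} - 1)"
    have t: "2 ^ t \<le> card {b. X n l a b}" "card {b. X n l a b} \<le> 2 ^ (t + 1)"
      using len_lower[of "card {b. X n l a b} - 1"] len_upper[of "card {b. X n l a b} - 1"] pos
      by (simp_all add: t_def)
    have "at_least (2 ^ t) (X n l a)" using fin t(1) by (rule at_least_card)
    moreover have XY: "X n l = (\<lambda>a b. (a, b) \<in> Y)" by (simp add: Y_def)
    ultimately have large: "at_least (2 ^ t) (\<lambda>b. (a, b) \<in> Y)" by simp
    note A = card_at_least_power[OF Y(1) cardY large]
    have Kb: "K b a \<le> (t + 1) + 2 * len (pair n l) + c1"
      using Xab fin t(2) by (intro c1) simp_all
    have Ka: "K a 0 \<le> (n + l - t) + 2 * len (pair t (pair n l)) + c2"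
      using large A unfolding XY by (intro c2) (simp_all add: Y_def)
    have "len n \<le> L" "len l \<le> L" "len t \<le> L"
      unfolding L_def using A(2) by (auto intro: len_mono)
    then have pairs: "len (pair n l) \<le> 4 * L + 4"
      using len_pair[of n l] by simp
    then have "len (pair t (pair n l)) \<le> 10 * L + 12"
      using len_pair[of t "pair n l"] \<open>len t \<le> L\<close> by simp
    \<comment> \<open>The constants are \<open>2 * (4 * L + 4)\<close> for the first description,
      \<open>2 * (10 * L + 12)\<close> for the second, and 1 for rounding \<open>t\<close>.\<close>
    with pairs have "K a 0 + K b a \<le> n + l + (28 * L + 33 + c1 + c2)"
      using Ka Kb A(2) by linarith
    also have "\<dots> \<le> n + l + (c1 + c2 + 33) * (L + 1)" by (simp add: algebra_simps)
    finally show ?thesis unfolding n_def l_def L_def .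
  qed
  then show ?thesis by blast
qed

text \<open>The condition \<open>K b f < m\<close> on strings \<open>f\<close> of length
  \<open>k\<close>, stated through a program so that it is visibly enumerable.\<close>

definition simple_given :: "nat \<Rightarrow> nat \<Rightarrow> nat \<Rightarrow> nat \<Rightarrow> bool" where
  "simple_given k m b f \<longleftrightarrow> len f = k \<and> (\<exists>p. len p < m \<and> runs p f b)"

lemma re_simple_given:
  assumes "tc k" "tc m" "tc b" "tc f"
  shows "re (\<lambda>x. simple_given (k x) (m x) (b x) (f x))"
proof -
  have "re (\<lambda>z. simple_given (pfst z) (pfst (psnd z)) (pfst (psnd (psnd z))) (psnd (psnd (psnd z))))"
    unfolding simple_given_def by (intro re_ex re_conj re_dec re_runs tc_len tc_intros)
  then show ?thesis
    using re_comp[of "\<lambda>z. simple_given (pfst z) (pfst (psnd z)) (pfst (psnd (psnd z)))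
        (psnd (psnd (psnd z)))" "\<lambda>x. pair (k x) (pair (m x) (pair (b x) (f x)))"] assms
    by (simp add: tc_pair)
qed

lemma finite_simple_given: "finite {f. simple_given k m b f}"
  by (rule finite_subset[of _ "{f. len f = k}"]) (auto simp: simple_given_def)

text \<open>A pair \<open>(b, f)\<close> is determined by \<open>f\<close> and a program shorter
  than \<open>m\<close>, so there are at most \<open>2 ^ (k + m)\<close> such pairs and at most
  \<open>2 ^ (k + m - h)\<close> strings \<open>b\<close> that occur with \<open>2 ^ h\<close>
  strings \<open>f\<close>.\<close>

lemma K_le_of_often_simple:
  "\<exists>c. \<forall>k m h b. 2 ^ h \<le> card {f. simple_given k m b f} \<longrightarrow>
    K b 0 + h \<le> k + m + 2 * len (pair h (pair k m)) + c"
proof -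
  have "re (\<lambda>z. at_least (2 ^ pfst (pfst z))
      (simple_given (pfst (psnd (pfst z))) (psnd (psnd (pfst z))) (psnd (psnd z))))"
    by (intro re_at_least re_simple_given tc_intros)
  from K_enumeration[of "\<lambda>w v u. at_least (2 ^ pfst w) (simple_given (pfst (psnd w)) (psnd (psnd w)) u)",
      OF this]
  obtain c where c: "\<And>w v u n. at_least (2 ^ pfst w) (simple_given (pfst (psnd w)) (psnd (psnd w)) u) \<Longrightarrow>
      finite {u. at_least (2 ^ pfst w) (simple_given (pfst (psnd w)) (psnd (psnd w)) u)} \<Longrightarrow>
      card {u. at_least (2 ^ pfst w) (simple_given (pfst (psnd w)) (psnd (psnd w)) u)} \<le> 2 ^ n \<Longrightarrow>
      K u v \<le> n + 2 * len w + c"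
    by blast
  have "K b 0 + h \<le> k + m + 2 * len (pair h (pair k m)) + c"
    if h: "2 ^ h \<le> card {f. simple_given k m b f}" for k m h b
  proof -
    define Y where "Y = {(b, f). simple_given k m b f}"
    define P where "P = {p. len p < m} \<times> {f. len f = k}"
    define R where "R pf x \<longleftrightarrow> snd pf = snd x \<and> runs (fst pf) (snd x) (fst x)"
      for pf x :: "nat \<times> nat"
    have "finite P" by (simp add: P_def)
    moreover have "\<exists>pf\<in>P. R pf x" if "x \<in> Y" for x
      using that by (force simp: Y_def simple_given_def P_def R_def)
    moreover have "x = x'" if "R pf x" "R pf x'" for pf x x'
      using that runs_functional unfolding R_def by (metis prod.expand)
    ultimately have Y: "finite Y" "card Y \<le> card P"
      using card_le_of_witness[of P Y R] by blast+
    have "card Y \<le> card {p. len p < m} * 2 ^ k"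
      using Y(2) by (simp add: P_def card_cartesian_product)
    also have "\<dots> \<le> 2 ^ m * 2 ^ k" by (rule mult_le_mono1[OF card_len_less])
    finally have cardY: "card Y \<le> 2 ^ (k + m)" by (simp add: power_add mult.commute)
    have "at_least (2 ^ h) (simple_given k m b)" using finite_simple_given h by (rule at_least_card)
    moreover have simple_Y: "simple_given k m = (\<lambda>b f. (b, f) \<in> Y)" by (simp add: Y_def)
    ultimately have large: "at_least (2 ^ h) (\<lambda>f. (b, f) \<in> Y)" by simp
    note A = card_at_least_power[OF Y(1) cardY large]
    have "K b 0 \<le> (k + m - h) + 2 * len (pair h (pair k m)) + c"
      using large A by (intro c) (simp_all add: simple_Y)
    then show ?thesis using A(2) by linarith
  qed
  then show ?thesis by blast
qed

text \<open>Given \<open>b\<close>, one enumerates all \<open>a\<close> for which some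
  \<open>p\<close> has only simple fingerprints. The condition \<open>h + 1 \<le> k\<close> says
  that the simple strings fill at most half of the block, so \<open>card_all_fingerprints\<close>
  leaves at most \<open>2 ^ h\<close> such \<open>a\<close>.\<close>

lemma K_le_of_all_simple:
  "\<exists>c. \<forall>N k m h a b p. len a \<le> N \<longrightarrow> len p = k \<longrightarrow>
    (\<forall>j<shift_count N k. simple_given k m b (fingerprint N k a j p)) \<longrightarrow>
    card {f. simple_given k m b f} \<le> 2 ^ h \<longrightarrow> h + 1 \<le> k \<longrightarrow>
    K a b \<le> h + 2 * len (pair N (pair k m)) + c"
proof -
  define Q where "Q w b a \<longleftrightarrow> len a \<le> pfst w \<and> (\<exists>p. len p = pfst (psnd w) \<and>
    (\<forall>j<shift_count (pfst w) (pfst (psnd w)). simple_given (pfst (psnd w)) (psnd (psnd w)) b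
      (fingerprint (pfst w) (pfst (psnd w)) a j p)))" for w b a
  have "re (\<lambda>z. Q (pfst z) (pfst (psnd z)) (psnd (psnd z)))"
    unfolding Q_def
    by (intro re_conj re_ex re_ball re_dec re_simple_given tc_fingerprint tc_shift_count tc_len tc_intros)
  from K_enumeration[of Q, OF this]
  obtain c where c: "\<And>w v u n. Q w v u \<Longrightarrow> finite {u. Q w v u} \<Longrightarrow> card {u. Q w v u} \<le> 2 ^ n \<Longrightarrow>
      K u v \<le> n + 2 * len w + c"
    by blast
  have "K a b \<le> h + 2 * len (pair N (pair k m)) + c"
    if "len a \<le> N" "len p = k"
      "\<forall>j<shift_count N k. simple_given k m b (fingerprint N k a j p)"
      and card: "card {f. simple_given k m b f} \<le> 2 ^ h" and "h + 1 \<le> k" for N k m h a b p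
  proof -
    have "(2::nat) ^ (h + 1) \<le> 2 ^ k" using \<open>h + 1 \<le> k\<close> by (intro power_increasing) auto
    then have half: "2 * card {f. simple_given k m b f} \<le> 2 ^ k" using card by simp
    have sub: "{f. simple_given k m b f} \<subseteq> {f. len f = k}" by (auto simp: simple_given_def)
    have "len a \<le> N \<and> (\<exists>p. len p = k \<and>
        (\<forall>j<shift_count N k. fingerprint N k a j p \<in> {f. simple_given k m b f}))"
      if "a \<in> {a. Q (pair N (pair k m)) b a}" for a
      using that by (simp add: Q_def)
    then have few: "finite {a. Q (pair N (pair k m)) b a}"
      "card {a. Q (pair N (pair k m)) b a} \<le> card {f. simple_given k m b f}"
      using card_all_fingerprints[OF sub half, of "{a. Q (pair N (pair k m)) b a}" N] by blast+
    show ?thesis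
    proof (rule c)
      show "Q (pair N (pair k m)) b a" using that(1-3) by (auto simp: Q_def)
    qed (use few card in simp_all)
  qed
  then show ?thesis by blast
qed

end

section \<open>Fingerprints that reveal little\<close>

lemma len_linear:
  assumes "x \<le> u * N + v"
  shows "len x \<le> len N + (u + v + 1)"
proof -
  have "x + 1 \<le> (u + v + 1) * (N + 1)" using assms by (simp add: algebra_simps)
  also have "\<dots> < 2 ^ (u + v + 1) * 2 ^ (len N + 1)"
    using len_upper[of N] less_exp[of "u + v + 1"] by (intro mult_strict_mono) auto
  also have "\<dots> = 2 ^ (len N + (u + v + 1) + 1)" by (simp add: power_add)
  finally show ?thesis unfolding len_le_iff .
qed

lemma len_triple_le:
  assumes "len x \<le> e" "len y \<le> e" "len z \<le> e"
  shows "len (pair x (pair y z)) \<le> 10 * e + 12"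
proof -
  have "len (pair y z) \<le> 4 * e + 4" using len_pair[of y z] assms by simp
  then show ?thesis using len_pair[of x "pair y z"] assms by simp
qed

context optimal_language
begin

text \<open>\<open>w\<close> codes the number of the shift together with \<open>N\<close>; the
  remaining parameter \<open>k\<close> is the length of \<open>f\<close>.\<close>

definition decodes :: "nat \<Rightarrow> nat \<Rightarrow> nat \<Rightarrow> nat \<Rightarrow> bool" where
  "decodes w f a b \<longleftrightarrow>
    (\<exists>p. len p = len f \<and> f = fingerprint (psnd w) (len f) a (pfst w) p \<and> runs p a b)"

lemma decodes_functional:
  assumes "decodes w f a b" "decodes w f a b'"
  shows "b = b'"
proof -
  obtain p where p: "len p = len f" "f = fingerprint (psnd w) (len f) a (pfst w) p" "runs p a b"
    using assms(1) unfolding decodes_def by blast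
  obtain p' where p': "len p' = len f" "f = fingerprint (psnd w) (len f) a (pfst w) p'" "runs p' a b'"
    using assms(2) unfolding decodes_def by blast
  have "p = p'" using p(1) p'(1) trans[OF p(2)[symmetric] p'(2)] by (rule fingerprint_inj)
  then show ?thesis using p(3) p'(3) runs_functional by blast
qed

lemma re_decodes:
  assumes "tc w" "tc f" "tc a" "tc b"
  shows "re (\<lambda>x. decodes (w x) (f x) (a x) (b x))"
proof -
  have "re (\<lambda>z. decodes (pfst z) (pfst (psnd z)) (pfst (psnd (psnd z))) (psnd (psnd (psnd z))))"
    unfolding decodes_def by (intro re_ex re_conj re_dec re_runs tc_len tc_fingerprint tc_intros)
  then show ?thesis
    using re_comp[of "\<lambda>z. decodes (pfst z) (pfst (psnd z)) (pfst (psnd (psnd z))) (psnd (psnd (psnd z)))"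
        "\<lambda>x. pair (w x) (pair (f x) (pair (a x) (b x)))"] assms by (simp add: tc_pair)
qed

lemma K_le_decodes_pair: "\<exists>c. \<forall>w f a b. decodes w f a b \<longrightarrow> K b (spair f a) \<le> len w + c"
proof -
  define G where "G w v b \<longleftrightarrow> (\<exists>f a. v = spair f a \<and> decodes w f a b)" for w v b
  have re: "re (\<lambda>z. G (pfst z) (pfst (psnd z)) (psnd (psnd z)))"
    unfolding G_def by (intro re_ex re_conj re_dec re_decodes tc_spair tc_intros)
  have functional: "b = b'" if "G w v b" "G w v b'" for w v b b'
    using that unfolding G_def by (metis spair_inject decodes_functional)
  have "\<exists>c. \<forall>w v b. G w v b \<longrightarrow> K b v \<le> len w + c"
    by (rule K_bound[OF re]) (rule functional)
  then obtain c where c: "\<And>w v b. G w v b \<Longrightarrow> K b v \<le> len w + c" by blast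
  have "K b (spair f a) \<le> len w + c" if "decodes w f a b" for w f a b
    using that by (intro c) (auto simp: G_def)
  then show ?thesis by blast
qed

text \<open>The unknown \<open>a\<close> is supplied by a shortest program for it, preceded by
  \<open>w\<close> in doubled digits.\<close>

lemma K_le_decodes:
  "\<exists>c. \<forall>w f a b. decodes w f a b \<longrightarrow> K b f \<le> K a 0 + 2 * len w + c"
proof -
  define G where "G p f b \<longleftrightarrow> (\<exists>w q a. p = spair w q \<and> runs q 0 a \<and> decodes w f a b)" for p f b
  have re: "re (\<lambda>z. G (pfst z) (pfst (psnd z)) (psnd (psnd z)))"
    unfolding G_def by (intro re_ex re_conj re_dec re_runs re_decodes tc_spair tc_intros)
  have functional: "b = b'" if "G p f b" "G p f b'" for p f b b'
    using that unfolding G_def by (metis spair_inject runs_functional decodes_functional)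
  have "\<exists>c. \<forall>p f b. G p f b \<longrightarrow> K b f \<le> len p + c"
    by (rule K_bound[OF re]) (rule functional)
  then obtain c where c: "\<And>p f b. G p f b \<Longrightarrow> K b f \<le> len p + c" by blast
  have "K b f \<le> K a 0 + 2 * len w + (c + 2)" if "decodes w f a b" for w f a b
  proof -
    obtain q where "len q = K a 0" "runs q 0 a" using K_program by blast
    then have "K b f \<le> len (spair w q) + c" using that by (intro c) (auto simp: G_def)
    then show ?thesis using \<open>len q = K a 0\<close> by (simp add: len_spair)
  qed
  then show ?thesis by blast
qed

lemma K_le_unconditional: "\<exists>c. \<forall>b f. K b f \<le> K b 0 + c"
proof -
  have re: "re (\<lambda>z. runs (pfst z) 0 (psnd (psnd z)))" by (intro re_runs tc_intros)
  have "\<exists>c. \<forall>p v b. runs p 0 b \<longrightarrow> K b v \<le> len p + c"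
    by (rule K_bound[of "\<lambda>p v b. runs p 0 b", OF re]) (rule runs_functional)
  then show ?thesis using K_program by metis
qed

lemma exists_fingerprint_not_simple:
  "\<exists>C. \<forall>N a b p. len a \<le> N \<longrightarrow> len b \<le> N \<longrightarrow> len p = K b a \<longrightarrow>
    (\<exists>j<shift_count N (K b a).
      min (K a 0) (K b 0) \<le> K b (fingerprint N (K b a) a j p) + C * (len N + 1))"
proof -
  obtain c0 where c0: "\<And>u v. K u v \<le> len u + c0" using K_le_len by blast
  obtain c4 where c4: "\<And>k m h b. 2 ^ h \<le> card {f. simple_given k m b f} \<Longrightarrow>
      K b 0 + h \<le> k + m + 2 * len (pair h (pair k m)) + c4"
    using K_le_of_often_simple by blast
  obtain c5 where c5: "\<And>N k m h a b p. len a \<le> N \<Longrightarrow> len p = k \<Longrightarrow>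
      \<forall>j<shift_count N k. simple_given k m b (fingerprint N k a j p) \<Longrightarrow>
      card {f. simple_given k m b f} \<le> 2 ^ h \<Longrightarrow> h + 1 \<le> k \<Longrightarrow>
      K a b \<le> h + 2 * len (pair N (pair k m)) + c5"
    using K_le_of_all_simple by blast
  obtain c6 where c6: "\<And>a b. K a 0 + K b a \<le> K b 0 + K a b + c6 * (len (K b 0 + K a b) + 1)"
    using symmetry_of_information by blast
  define E where "E N = 10 * (len N + c0 + 2) + 12" for N
  \<comment> \<open>The sum of all overheads: \<open>2 * E N\<close> plus a constant for each of the
    two enumerations, the error of symmetry of information, and 2. One unit of the 2 pays for
    rounding up to \<open>2 ^ (h + 1)\<close>, the other for halving the block in one use and for
    strictness in the other.\<close>
  define Z where "Z N = 4 * E N + c4 + c5 + 2 + c6 * (len N + 2 * c0 + 4)" for N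
  have main: "\<exists>j<shift_count N (K b a).
      min (K a 0) (K b 0) \<le> K b (fingerprint N (K b a) a j p) + Z N"
    if a: "len a \<le> N" and b: "len b \<le> N" and p: "len p = K b a" for N a b p
  proof -
    define k m where "k = K b a" and "m = min (K a 0) (K b 0) - Z N"
    have "\<exists>j<shift_count N k. \<not> simple_given k m b (fingerprint N k a j p)"
    proof (rule ccontr)
      assume "\<not> ?thesis"
      then have all: "\<forall>j<shift_count N k. simple_given k m b (fingerprint N k a j p)" by blast
      \<comment> \<open>Shift number 0 always exists. Its simplicity shows that the truncated
        difference \<open>m\<close> is positive, hence exact, and that the set of simple strings is
        nonempty.\<close>
      then have "simple_given k m b (fingerprint N k a 0 p)" by (simp add: shift_count_def)
      then have "m > 0" and "{f. simple_given k m b f} \<noteq> {}"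
        by (auto simp only: simple_given_def less_nat_zero_code)
      then have pos: "card {f. simple_given k m b f} > 0"
        using finite_simple_given by (metis card_gt_0_iff)
      define h where "h = len (card {f. simple_given k m b f} - 1)"
      have h: "2 ^ h \<le> card {f. simple_given k m b f}" "card {f. simple_given k m b f} \<le> 2 ^ (h + 1)"
        using len_lower[of "card {f. simple_given k m b f} - 1"]
          len_upper[of "card {f. simple_given k m b f} - 1"] pos
        by (simp_all add: h_def)
      have "card {f. simple_given k m b f} \<le> card {f. len f = k}"
        by (rule card_mono) (auto simp: simple_given_def)
      then have "(2::nat) ^ h \<le> 2 ^ k" using h(1) card_len_eq[of k] by linarith
      then have "h \<le> k" by simp
      have K_le: "K b a \<le> N + c0" "K b 0 \<le> N + c0" "K a b \<le> N + c0"
        using c0[of b a] c0[of b 0] c0[of a b] a b by linarith+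
      then have "k \<le> N + c0" "m \<le> N + c0" "h \<le> N + c0"
        using \<open>h \<le> k\<close> by (auto simp: k_def m_def)
      then have lens: "len k \<le> len N + c0 + 2" "len m \<le> len N + c0 + 2" "len h \<le> len N + c0 + 2"
        using len_linear[of _ 1 N c0] by simp_all
      have "K b 0 + K a b \<le> 2 * N + 2 * c0" using K_le by simp
      then have "len (K b 0 + K a b) + 1 \<le> len N + 2 * c0 + 4"
        using len_linear[of "K b 0 + K a b" 2 N "2 * c0"] by simp
      then have "c6 * (len (K b 0 + K a b) + 1) \<le> c6 * (len N + 2 * c0 + 4)" by (rule mult_le_mono2)
      then have sym: "K a 0 + k \<le> K b 0 + K a b + c6 * (len N + 2 * c0 + 4)"
        using c6[of a b] by (simp add: k_def)
      have "len (pair h (pair k m)) \<le> E N" unfolding E_def by (intro len_triple_le lens)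
      then have often: "K b 0 + h \<le> k + m + 2 * E N + c4" using c4[OF h(1)] by linarith
      have min: "m + Z N \<le> K a 0" "m + Z N \<le> K b 0" using \<open>m > 0\<close> by (auto simp: m_def)
      \<comment> \<open>Since \<open>K b 0\<close> exceeds \<open>m\<close> by at least
        \<open>Z N\<close>, \<open>often\<close> forces \<open>h\<close> below \<open>k\<close>;
        this is the half-size condition for \<open>2 ^ (h + 1)\<close>.\<close>
      have "h + 1 + 1 \<le> k" using often min(2) unfolding Z_def by linarith
      then have "K a b \<le> (h + 1) + 2 * len (pair N (pair k m)) + c5"
        using a p all h(2) by (intro c5) (auto simp: k_def)
      moreover have "len (pair N (pair k m)) \<le> E N"
        unfolding E_def by (intro len_triple_le lens) simp
      ultimately have "K a b \<le> (h + 1) + 2 * E N + c5" by linarith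
      then show False using sym often min(1) unfolding Z_def by linarith
    qed
    then obtain j where j: "j < shift_count N k"
      and not_simple: "\<not> simple_given k m b (fingerprint N k a j p)" by blast
    obtain q where q: "len q = K b (fingerprint N k a j p)" "runs q (fingerprint N k a j p) b"
      using K_program by blast
    have "\<not> len q < m" using not_simple q(2) unfolding simple_given_def len_fingerprint by blast
    then have "m \<le> K b (fingerprint N k a j p)" using q(1) by simp
    then show ?thesis using j unfolding m_def k_def by auto
  qed
  define C where "C = 40 * c0 + 132 + c4 + c5 + c6 * (2 * c0 + 4)"
  have "Z N \<le> C * (len N + 1)" for N
    by (simp add: Z_def E_def C_def algebra_simps)
  then show ?thesis using main by (meson add_left_mono order_trans)
qed

text \<open>Both upper bounds hold for every fingerprint whose shift number is small; only the lower
  bound depends on the choice of \<open>j\<close>.\<close>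

theorem conditional_code:
  "\<exists>C. \<forall>N a b. len a \<le> N \<longrightarrow> len b \<le> N \<longrightarrow>
    (\<exists>f. len f = K b a \<and> K b (spair f a) \<le> C * (len N + 1) \<and>
      K b f \<le> min (K a 0) (K b 0) + C * (len N + 1) \<and>
      min (K a 0) (K b 0) \<le> K b f + C * (len N + 1))"
proof -
  obtain c0 where c0: "\<And>u v. K u v \<le> len u + c0" using K_le_len by blast
  obtain c1 where c1: "\<And>w f a b. decodes w f a b \<Longrightarrow> K b (spair f a) \<le> len w + c1"
    using K_le_decodes_pair by blast
  obtain c2 where c2: "\<And>w f a b. decodes w f a b \<Longrightarrow> K b f \<le> K a 0 + 2 * len w + c2"
    using K_le_decodes by blast
  obtain c3 where c3: "\<And>b f. K b f \<le> K b 0 + c3" using K_le_unconditional by blast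
  obtain C where C: "\<And>N a b p. len a \<le> N \<Longrightarrow> len b \<le> N \<Longrightarrow> len p = K b a \<Longrightarrow>
    \<exists>j<shift_count N (K b a).
      min (K a 0) (K b 0) \<le> K b (fingerprint N (K b a) a j p) + C * (len N + 1)"
    using exists_fingerprint_not_simple by blast
  define M where "M = C + c1 + c2 + c3 + 8 * c0 + 48"
  have "\<exists>f. len f = K b a \<and> K b (spair f a) \<le> M * (len N + 1) \<and>
      K b f \<le> min (K a 0) (K b 0) + M * (len N + 1) \<and>
      min (K a 0) (K b 0) \<le> K b f + M * (len N + 1)"
    if a: "len a \<le> N" and b: "len b \<le> N" for N a b
  proof -
    obtain p where p: "len p = K b a" "runs p a b" using K_program by blast
    obtain j where j: "j < shift_count N (K b a)"
      and lower: "min (K a 0) (K b 0) \<le> K b (fingerprint N (K b a) a j p) + C * (len N + 1)"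
      using C[OF a b p(1)] by blast
    define f where "f = fingerprint N (K b a) a j p"
    define w where "w = pair j N"
    have decodes: "decodes w f a b" using p unfolding decodes_def f_def w_def by auto
    have "K b a \<le> N + c0" using c0[of b a] b by linarith
    \<comment> \<open>The number of shifts is linear in \<open>N\<close>, so \<open>j\<close> is
      specified by a logarithmic number of bits.\<close>
    then have "j \<le> 3 * N + (2 * c0 + 5)" using j unfolding shift_count_def by linarith
    then have "len j \<le> len N + (2 * c0 + 9)" using len_linear[of j 3 N "2 * c0 + 5"] by simp
    then have len_w: "len w \<le> 4 * len N + 4 * c0 + 22" using len_pair[of j N] by (simp add: w_def)
    have "len w + c1 \<le> M * (len N + 1)" "2 * len w + c2 \<le> M * (len N + 1)"
      "c3 \<le> M * (len N + 1)" "C * (len N + 1) \<le> M * (len N + 1)"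
      using len_w by (simp_all add: M_def algebra_simps)
    then show ?thesis
      using c1[OF decodes] c2[OF decodes] c3[of b f] lower
      by (intro exI[of _ f]) (auto simp: f_def min_def)
  qed
  then show ?thesis by blast
qed

end

section \<open>From numbers and lengths to strings and logarithms\<close>

lemma len_le_log:
  assumes "N \<ge> 2"
  shows "real (len N) \<le> 2 * log 2 (real N)"
proof -
  have "2 ^ len N \<le> N + 1" by (rule len_lower)
  also have "\<dots> \<le> 2 * N" using assms by simp
  also have "\<dots> \<le> N ^ 2" unfolding power2_eq_square using assms by (rule mult_le_mono1)
  finally have "real (2 ^ len N) \<le> real (N ^ 2)" by (simp only: of_nat_le_iff)
  then have "log 2 (2 ^ len N) \<le> log 2 (real N ^ 2)" using assms by (subst log_le_cancel_iff) auto
  then show ?thesis using assms by (simp add: log_nat_power)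
qed

text \<open>The bound starts at \<open>N = 2\<close> because the logarithm vanishes at
  \<open>N = 1\<close>, where complexities may still be positive.\<close>

theorem theorem3:
  fixes D :: "bool list \<Rightarrow> bool list \<Rightarrow> bool list option"
  assumes "optimal_lang D"
  shows "\<exists>C::real. \<forall>N::nat. \<forall>a b :: bool list.
           N \<ge> 2 \<longrightarrow> length a \<le> N \<longrightarrow> length b \<le> N \<longrightarrow>
           (\<exists>f :: bool list. length f = KSc D b a \<and>
              real (KSc D b (pair_str f a)) \<le> C * log 2 (real N) \<and>
              \<bar>real (KSc D b f) - real (min (KS D a) (KS D b))\<bar> \<le> C * log 2 (real N))"
proof -
  interpret optimal_language D by standard (rule assms)
  obtain C where C: "\<And>N a b. len a \<le> N \<Longrightarrow> len b \<le> N \<Longrightarrow>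
    \<exists>f. len f = K b a \<and> K b (spair f a) \<le> C * (len N + 1) \<and>
      K b f \<le> min (K a 0) (K b 0) + C * (len N + 1) \<and>
      min (K a 0) (K b 0) \<le> K b f + C * (len N + 1)"
    using conditional_code by blast
  have str_0: "str 0 = []" using str_nat_of_str[of "[]"] by simp
  have "\<exists>f. length f = KSc D b a \<and>
      real (KSc D b (pair_str f a)) \<le> real (3 * C) * log 2 (real N) \<and>
      \<bar>real (KSc D b f) - real (min (KS D a) (KS D b))\<bar> \<le> real (3 * C) * log 2 (real N)"
    if N: "N \<ge> 2" and ab: "length a \<le> N" "length b \<le> N" for N and a b :: "bool list"
  proof -
    define x y where "x = nat_of_str a" and "y = nat_of_str b"
    obtain g where g: "len g = K y x" "K y (spair g x) \<le> C * (len N + 1)"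
      "K y g \<le> min (K x 0) (K y 0) + C * (len N + 1)"
      "min (K x 0) (K y 0) \<le> K y g + C * (len N + 1)"
      using C[of x N y] ab by (auto simp: x_def y_def len_def)
    \<comment> \<open>This absorbs the additive 1: \<open>len N + 1\<close> is at most three times
      the logarithm, whence the constant \<open>3 * C\<close>.\<close>
    have "log 2 (real N) \<ge> 1" using N by (simp add: le_log_iff)
    then have "real C * (real (len N) + 1) \<le> real C * (3 * log 2 (real N))"
      using len_le_log[OF N] by (intro mult_left_mono) auto
    then have bound: "real (C * (len N + 1)) \<le> real (3 * C) * log 2 (real N)"
      by (simp add: algebra_simps)
    have strings: "K y x = KSc D b a" "K x 0 = KS D a" "K y 0 = KS D b"
      "K y g = KSc D b (str g)" "K y (spair g x) = KSc D b (pair_str (str g) a)"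
      by (simp_all add: K_def KS_def x_def y_def str_0 spair_def)
    show ?thesis
    proof (intro exI[of _ "str g"] conjI)
      show "length (str g) = KSc D b a" using g(1) strings by (simp add: len_def)
      show "real (KSc D b (pair_str (str g) a)) \<le> real (3 * C) * log 2 (real N)"
        using g(2) bound unfolding strings by (simp only: of_nat_le_iff[where 'a=real, symmetric])
      have "real (KSc D b (str g)) \<le> real (min (KS D a) (KS D b)) + real (C * (len N + 1))"
        "real (min (KS D a) (KS D b)) \<le> real (KSc D b (str g)) + real (C * (len N + 1))"
        using g(3,4) unfolding strings by (simp_all only: of_nat_le_iff flip: of_nat_add)
      then show "\<bar>real (KSc D b (str g)) - real (min (KS D a) (KS D b))\<bar> \<le> real (3 * C) * log 2 (real N)"
        using bound by linarith
    qed
  qed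
  then show ?thesis by blast
qed

end
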